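(* Let $\mathbf{X}=\mathbf{Z}\odot_1\boldsymbol{\Omega}_1\cdots\odot_r\boldsymbol{\Omega}_r$ be a random tensor in $\mathbb{R}^{p_1\times\cdots\times p_r}$ following the tensor-valued independent component model (with $\boldsymbol{\mu}=\mathbf{0}$), where the components of $\mathbf{Z}$ have finite fourth moments. For each $m$ let $\mathbf{S}_m^{-1/2}$ be any inverse square root of $\mathbf{S}_m=\mathrm{cov}_{(m)}(\mathbf{X})$, let $\boldsymbol{\Omega}_m=\mathbf{U}_m\mathbf{D}_m\mathbf{V}_m^\top$ be a singular value decomposition, and let $\mathbf{M}_m$ be the orthogonal matrix with $\mathbf{S}_m^{-1/2}=\big(\prod_{s\neq m}p_s^{1/2}\|\mathbf{D}_s\|_F^{-1}\big)\mathbf{M}_m\mathbf{D}_m^{-1}\mathbf{U}_m^\top$. Put $\rho_m=\prod_{s\neq m}p_s$, $\mathbf{W}_m=\mathbf{M}_m\mathbf{V}_m^\top$, $\tau=\prod_{m=1}^r\prod_{s\neq m}p_s^{1/2}\|\mathbf{D}_s\|_F^{-1}$, and let $\mathbf{X}^{st}=\mathbf{X}\odot_1\mathbf{S}_1^{-1/2}\cdots\odot_r\mathbf{S}_r^{-1/2}$, $$\mathbf{B}_m^0=\rho_m^{-1}\mathrm{E}\{(\mathbf{X}^{st}\odot_{-m}\mathbf{X}^{st})^2\},\qquad \mathbf{B}_m^1=\rho_m^{-1}\mathrm{E}\{\|\mathbf{X}^{st}\|_F^2\,(\mathbf{X}^{st}\odot_{-m}\mathbf{X}^{st})\}.$$ Let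 $\boldsymbol{\beta}\in\mathbb{R}^{p_1\times\cdots\times p_r}$ be the tensor with entries $\mathrm{E}(z_{i_1\ldots i_r}^4)$. Then, for each $m=1,\ldots,r$, $$\mathbf{B}_m^0=\tau^4\,\mathbf{W}_m\left\{(p_m-1+\rho_m-1)\mathbf{I}_{p_m}+\mathrm{diag}(\bar{\boldsymbol{\beta}}_{-m})\right\}\mathbf{W}_m^\top,$$ $$\mathbf{B}_m^1=\tau^4\,\mathbf{W}_m\left\{(p_m\rho_m-1)\mathbf{I}_{p_m}+\mathrm{diag}(\bar{\boldsymbol{\beta}}_{-m})\right\}\mathbf{W}_m^\top,$$ where $\mathrm{diag}(\bar{\boldsymbol{\beta}}_{-m})$ is the diagonal matrix with the elements of $\bar{\boldsymbol{\beta}}_{-m}\in\mathbb{R}^{p_m}$ on its diagonal.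
   Context: Tensor-matrix product: for $\mathbf{A}\in\mathbb{R}^{p_1\times\cdots\times p_r}$ and $\mathbf{B}\in\mathbb{R}^{q_m\times p_m}$, $\mathbf{A}\odot_m\mathbf{B}$ is the tensor with entries $(\mathbf{A}\odot_m\mathbf{B})_{i_1\ldots j_m\ldots i_r}=\sum_{i_m}a_{i_1\ldots i_m\ldots i_r}b_{j_m i_m}$. Successive products are applied from left to right. $m$-mode product of two tensors: $\mathbf{A}\odot_{-m}\mathbf{B}$ is the $p_m\times p_m$ matrix whose $(s,t)$ entry is $\sum a_{i_1\ldots i_{m-1}\,s\,i_{m+1}\ldots i_r}\,b_{i_1\ldots i_{m-1}\,t\,i_{m+1}\ldots i_r}$, summed over all $i_j$, $j\neq m$. For a zero-mean random tensor, $\mathrm{cov}_{(m)}(\mathbf{X})=\big(\prod_{s\neq m}p_s\big)^{-1}\mathrm{E}(\mathbf{X}\odot_{-m}\mathbf{X})$. For a tensor $\mathbf{A}\in\mathbb{R}^{p_1\times\cdots\times p_r}$, $\bar{\mathbf{A}}_{-m}$ is the $p_m$-vector whose $i_m$th element is the mean of the $\rho_m$ elements of $\mathbf{A}$ whose $m$th index equals $i_m$. $\|\mathbf{A}\|_F^2$ is the sum of squared elements. Tensor-valued independent component model: $\mathbf{X}=\boldsymbol{\mu}+\mathbf{Z}\odot_1\boldsymbol{\Omega}_1\cdots\odot_r\boldsymbol{\Omega}_r$ with each $\boldsymbol{\Omega}_m\in\mathbb{R}^{p_m\times p_m}$ non-singular, and $\mathbf{Z}\in\mathbb{R}^{p_1\times\cdots\times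 p_r}$ a random tensor such that (1) its components are mutually independent with mean $0$ and variance $1$; (2) for each $m$, at most one $m$-mode face of $\mathbf{Z}$ (a subtensor obtained by fixing the value of the $m$th index) consists entirely of Gaussian components. In the singular value decompositions $\mathbf{U}_m,\mathbf{V}_m$ are orthogonal and $\mathbf{D}_m$ is diagonal with positive diagonal entries. An inverse square root of a symmetric positive definite $\mathbf{S}$ is any $\mathbf{G}$ with $\mathbf{G}\mathbf{S}\mathbf{G}^\top=\mathbf{I}$; every inverse square root of $\mathbf{S}_m$ is of the form stated in the claim. *)

theory Defs
  imports
    "HOL-Probability.Probability"
    "Jordan_Normal_Form.Gauss_Jordan_Elimination"
begin

section \<open>Tensors\<close>

text \<open>
  A real tensor with \<open>r\<close> modes of dimensions \<open>p 0, \<dots>, p (r - 1)\<close> is a function on multi-indices. Modes \<open>m\<close> and index values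
  \<open>i m\<close> are counted from 0, so that they match the indices of the matrix type. Values of a tensor
  outside \<^term>\<open>tensor_index r p\<close> are irrelevant: no definition below reads them when the dimensions
  of the matrices involved agree.
\<close>

type_synonym tensor = "(nat \<Rightarrow> nat) \<Rightarrow> real"

definition tensor_index :: "nat \<Rightarrow> (nat \<Rightarrow> nat) \<Rightarrow> (nat \<Rightarrow> nat) set" where
  "tensor_index r p = (\<Pi>\<^sub>E m\<in>{..<r}. {..<p m})"

definition rho :: "nat \<Rightarrow> (nat \<Rightarrow> nat) \<Rightarrow> nat \<Rightarrow> nat" where
  "rho r p m = (\<Prod>s\<in>{..<r} - {m}. p s)"

definition mode_prod :: "nat \<Rightarrow> tensor \<Rightarrow> real mat \<Rightarrow> tensor" where
  "mode_prod m A B = (\<lambda>j. \<Sum>k<dim_col B. A (j(m := k)) * B $$ (j m, k))"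

definition all_modes_prod :: "nat \<Rightarrow> tensor \<Rightarrow> (nat \<Rightarrow> real mat) \<Rightarrow> tensor" where
  "all_modes_prod r A B = foldl (\<lambda>T m. mode_prod m T (B m)) A [0..<r]"

text \<open>
  The product of two tensors over all modes but \<open>m\<close>. The summation index \<open>i\<close> ranges over the
  multi-indices without an \<open>m\<close>th entry, which is then filled in by \<open>s\<close> or \<open>t\<close>.
\<close>

definition mode_inner :: "nat \<Rightarrow> (nat \<Rightarrow> nat) \<Rightarrow> nat \<Rightarrow> tensor \<Rightarrow> tensor \<Rightarrow> real mat" where
  "mode_inner r p m A B = Matrix.mat (p m) (p m)
     (\<lambda>(s, t). \<Sum>i\<in>(\<Pi>\<^sub>E j\<in>{..<r} - {m}. {..<p j}). A (i(m := s)) * B (i(m := t)))"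

definition face :: "nat \<Rightarrow> (nat \<Rightarrow> nat) \<Rightarrow> nat \<Rightarrow> nat \<Rightarrow> (nat \<Rightarrow> nat) set" where
  "face r p m k = {i \<in> tensor_index r p. i m = k}"

definition face_means :: "nat \<Rightarrow> (nat \<Rightarrow> nat) \<Rightarrow> nat \<Rightarrow> tensor \<Rightarrow> real Matrix.vec" where
  "face_means r p m A =
     Matrix.vec (p m) (\<lambda>k. (\<Sum>i\<in>face r p m k. A i) / real (rho r p m))"

definition tensor_fnorm :: "nat \<Rightarrow> (nat \<Rightarrow> nat) \<Rightarrow> tensor \<Rightarrow> real" where
  "tensor_fnorm r p A = sqrt (\<Sum>i\<in>tensor_index r p. (A i)\<^sup>2)"

section \<open>Matrices\<close>

definition mat_fnorm :: "real mat \<Rightarrow> real" where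
  "mat_fnorm A = sqrt (\<Sum>i<dim_row A. \<Sum>j<dim_col A. (A $$ (i, j))\<^sup>2)"

definition diag_of_vec :: "real Matrix.vec \<Rightarrow> real mat" where
  "diag_of_vec v = mat_diag (dim_vec v) (vec_index v)"

text \<open>
  The library predicate \<^const>\<open>orthogonal_mat\<close> only demands pairwise orthogonal nonzero columns;
  here the columns have to be orthonormal.
\<close>

definition orthonormal_mat :: "nat \<Rightarrow> real mat \<Rightarrow> bool" where
  "orthonormal_mat n Q \<longleftrightarrow>
     Q \<in> carrier_mat n n \<and> Q\<^sup>T * Q = 1\<^sub>m n \<and> Q * Q\<^sup>T = 1\<^sub>m n"

definition is_svd :: "nat \<Rightarrow> real mat \<Rightarrow> real mat \<Rightarrow> real mat \<Rightarrow> real mat \<Rightarrow> bool" where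
  "is_svd n A U D V \<longleftrightarrow>
     orthonormal_mat n U \<and> orthonormal_mat n V \<and>
     D \<in> carrier_mat n n \<and> diagonal_mat D \<and> (\<forall>i<n. D $$ (i, i) > 0) \<and>
     A = U * D * V\<^sup>T"

definition inverse_sqrt_of :: "nat \<Rightarrow> real mat \<Rightarrow> real mat \<Rightarrow> bool" where
  "inverse_sqrt_of n S G \<longleftrightarrow> G \<in> carrier_mat n n \<and> G * S * G\<^sup>T = 1\<^sub>m n"

section \<open>Random tensors\<close>

text \<open>
  A random tensor on the probability space \<open>P\<close> is a map from outcomes to tensors.
\<close>

definition expect_mat :: "'w measure \<Rightarrow> nat \<Rightarrow> ('w \<Rightarrow> real mat) \<Rightarrow> real mat" where
  "expect_mat P n F = Matrix.mat n n (\<lambda>(s, t). \<integral>\<omega>. F \<omega> $$ (s, t) \<partial>P)"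

definition gaussian_rv :: "'w measure \<Rightarrow> ('w \<Rightarrow> real) \<Rightarrow> bool" where
  "gaussian_rv P Y \<longleftrightarrow>
     (\<exists>a \<sigma>. \<sigma> > 0 \<and> distributed P lborel Y (\<lambda>x. ennreal (normal_density a \<sigma> x)))"

definition ic_source ::
    "'w measure \<Rightarrow> nat \<Rightarrow> (nat \<Rightarrow> nat) \<Rightarrow> ('w \<Rightarrow> tensor) \<Rightarrow> bool" where
  "ic_source P r p Z \<longleftrightarrow>
     prob_space.indep_vars P (\<lambda>_. borel) (\<lambda>i \<omega>. Z \<omega> i) (tensor_index r p) \<and>
     (\<forall>i\<in>tensor_index r p.
        integrable P (\<lambda>\<omega>. Z \<omega> i) \<and> (\<integral>\<omega>. Z \<omega> i \<partial>P) = 0 \<and>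
        integrable P (\<lambda>\<omega>. (Z \<omega> i)\<^sup>2) \<and>
        (\<integral>\<omega>. (Z \<omega> i - (\<integral>\<omega>'. Z \<omega>' i \<partial>P))\<^sup>2 \<partial>P) = 1) \<and>
     (\<forall>m<r. card {k. k < p m \<and> (\<forall>i\<in>face r p m k. gaussian_rv P (\<lambda>\<omega>. Z \<omega> i))} \<le> 1)"

definition tensor_ic_model ::
    "'w measure \<Rightarrow> nat \<Rightarrow> (nat \<Rightarrow> nat) \<Rightarrow> tensor \<Rightarrow> (nat \<Rightarrow> real mat) \<Rightarrow>
     ('w \<Rightarrow> tensor) \<Rightarrow> ('w \<Rightarrow> tensor) \<Rightarrow> bool" where
  "tensor_ic_model P r p \<mu> \<Omega> Z X \<longleftrightarrow>
     prob_space P \<and>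
     (\<forall>m<r. p m > 0) \<and>
     (\<forall>m<r. \<Omega> m \<in> carrier_mat (p m) (p m) \<and> invertible_mat (\<Omega> m)) \<and>
     ic_source P r p Z \<and>
     (\<forall>\<omega>\<in>space P. \<forall>i\<in>tensor_index r p.
        X \<omega> i = \<mu> i + all_modes_prod r (Z \<omega>) \<Omega> i)"

definition mode_cov ::
    "'w measure \<Rightarrow> nat \<Rightarrow> (nat \<Rightarrow> nat) \<Rightarrow> nat \<Rightarrow> ('w \<Rightarrow> tensor) \<Rightarrow> real mat" where
  "mode_cov P r p m X =
     (1 / real (rho r p m)) \<cdot>\<^sub>m expect_mat P (p m) (\<lambda>\<omega>. mode_inner r p m (X \<omega>) (X \<omega>))"

text \<open>
  In the next two definitions \<open>Y\<close> stands for the standardized random tensor.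
\<close>

definition B0_mat ::
    "'w measure \<Rightarrow> nat \<Rightarrow> (nat \<Rightarrow> nat) \<Rightarrow> nat \<Rightarrow> ('w \<Rightarrow> tensor) \<Rightarrow> real mat" where
  "B0_mat P r p m Y =
     (1 / real (rho r p m)) \<cdot>\<^sub>m
       expect_mat P (p m) (\<lambda>\<omega>. mode_inner r p m (Y \<omega>) (Y \<omega>) ^\<^sub>m 2)"

definition B1_mat ::
    "'w measure \<Rightarrow> nat \<Rightarrow> (nat \<Rightarrow> nat) \<Rightarrow> nat \<Rightarrow> ('w \<Rightarrow> tensor) \<Rightarrow> real mat" where
  "B1_mat P r p m Y =
     (1 / real (rho r p m)) \<cdot>\<^sub>m
       expect_mat P (p m)
         (\<lambda>\<omega>. (tensor_fnorm r p (Y \<omega>))\<^sup>2 \<cdot>\<^sub>m mode_inner r p m (Y \<omega>) (Y \<omega>))"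

definition mode_scale :: "nat \<Rightarrow> (nat \<Rightarrow> nat) \<Rightarrow> (nat \<Rightarrow> real mat) \<Rightarrow> nat \<Rightarrow> real" where
  "mode_scale r p D m = (\<Prod>s\<in>{..<r} - {m}. sqrt (real (p s)) * inverse (mat_fnorm (D s)))"

definition tau :: "nat \<Rightarrow> (nat \<Rightarrow> nat) \<Rightarrow> (nat \<Rightarrow> real mat) \<Rightarrow> real" where
  "tau r p D = (\<Prod>m<r. mode_scale r p D m)"

text \<open>
  \<open>Q\<close> is an orthogonal factor of the inverse square root \<open>G\<close> of the \<open>m\<close>-mode covariance.
  For a nonsingular diagonal \<open>D m\<close>, the inverse returned by \<^const>\<open>mat_inverse\<close> is never \<^const>\<open>None\<close>.
\<close>

definition orthogonal_factor ::
    "nat \<Rightarrow> (nat \<Rightarrow> nat) \<Rightarrow> (nat \<Rightarrow> real mat) \<Rightarrow> (nat \<Rightarrow> real mat) \<Rightarrow> nat \<Rightarrow>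
     real mat \<Rightarrow> real mat \<Rightarrow> bool" where
  "orthogonal_factor r p U D m G Q \<longleftrightarrow>
     orthonormal_mat (p m) Q \<and>
     G = mode_scale r p D m \<cdot>\<^sub>m (Q * the (mat_inverse (D m)) * (U m)\<^sup>T)"

end

theory Submission
  imports Defs "Jordan_Normal_Form.Determinant"
begin

text \<open>
  Successive mode products compose mode by mode, so the standardized tensor is \<open>\<tau>\<close> times the product of
  \<open>Z\<close> with the orthogonal matrices \<open>W\<^sub>m = M\<^sub>m V\<^sub>m\<^sup>T\<close>. Orthogonal factors on the modes other than \<open>m\<close>
  drop out of the \<open>m\<close>-mode product of a tensor with itself, and the one on mode \<open>m\<close> conjugates it; both
  claims are thereby reduced to the expectations of \<open>N\<^sup>2\<close> and \<open>tr(N) N\<close> with \<open>N\<close> the \<open>m\<close>-mode product of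
  \<open>Z\<close> with itself. Their entries are sums of fourth-order moments of independent standardized
  variables, which vanish as soon as one variable occurs exactly once.
\<close>

text \<open>The standardizing matrix of one mode depends on all the others: averaging over a mode j
  \<noteq> m replaces \<open>\<Omega> j\<close> by its squared Frobenius norm divided by
  \<open>p j\<close>, and that norm is the one of \<open>D j\<close>. So the covariance of mode m is
  c^(-2) \<open>\<Omega> m * (\<Omega> m)\<^sup>T\<close> with c =
  \<open>mode_scale r p D m\<close>. One inverse square root is then c D^(-1) U^T, and any other
  differs from it by an orthogonal factor on the left. This is the origin of the scalar in
  \<open>orthogonal_factor\<close> and of \<open>tau\<close>, where the scalars of all modes are
  collected. Both target matrices have degree four in the tensor, whence tau^4.

  The four factors of a moment carry multi-indices that can coincide in many ways. Splitting each
  multi-index into its mth entry and the remainder reduces this to comparisons among three entries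
  s, t, u and between two remainders i, k, which leaves a handful of cases.\<close>

lemma sum_PiE_insert:
  assumes "m \<notin> S"
  shows "(\<Sum>g\<in>Pi\<^sub>E (insert m S) T. f g) = (\<Sum>k\<in>T m. \<Sum>g\<in>Pi\<^sub>E S T. f (g(m := k)))"
proof -
  have "(\<Sum>g\<in>Pi\<^sub>E (insert m S) T. f g) = (\<Sum>(k, g)\<in>T m \<times> Pi\<^sub>E S T. f (g(m := k)))"
    unfolding PiE_insert_eq
    by (subst sum.reindex[OF inj_combinator[OF assms]]) (simp add: case_prod_unfold)
  also have "\<dots> = (\<Sum>k\<in>T m. \<Sum>g\<in>Pi\<^sub>E S T. f (g(m := k)))"
    by (simp add: sum.cartesian_product)
  finally show ?thesis .
qed

lemma index_mult_mat_sum: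
  assumes "A \<in> carrier_mat n k" "B \<in> carrier_mat k l" "i < n" "j < l"
  shows "(A * B) $$ (i, j) = (\<Sum>x<k. A $$ (i, x) * B $$ (x, j))"
  using assms by (auto simp: scalar_prod_def lessThan_atLeast0 intro!: sum.cong)

section \<open>Tensor products\<close>

lemma finite_tensor_index: "finite (tensor_index r p)"
  by (simp add: tensor_index_def finite_PiE)

abbreviation off_index :: "nat \<Rightarrow> (nat \<Rightarrow> nat) \<Rightarrow> nat \<Rightarrow> (nat \<Rightarrow> nat) set" where
  "off_index r p m \<equiv> (\<Pi>\<^sub>E j\<in>{..<r} - {m}. {..<p j})"

lemma finite_off_index: "finite (off_index r p m)"
  by (simp add: finite_PiE)

lemma card_off_index: "card (off_index r p m) = rho r p m"
  by (simp add: card_PiE rho_def)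

lemma fun_upd_off_index:
  "m < r \<Longrightarrow> i \<in> off_index r p m \<Longrightarrow> s < p m \<Longrightarrow> i(m := s) \<in> tensor_index r p"
  by (auto simp: tensor_index_def PiE_iff extensional_def)

text \<open>Both remainders are \<open>undefined\<close> at \<open>m\<close>, so overwriting that
  entry loses nothing. This is what decides later which variables in a fourth-order moment
  coincide.\<close>

lemma fun_upd_off_index_eq_iff:
  assumes "i \<in> off_index r p m" "k \<in> off_index r p m"
  shows "i(m := s) = k(m := t) \<longleftrightarrow> i = k \<and> s = t"
proof
  assume eq: "i(m := s) = k(m := t)"
  have "i x = k x" for x
    using fun_cong[OF eq, of x] assms by (cases "x = m") (auto simp: PiE_iff extensional_def)
  thus "i = k \<and> s = t"
    using fun_cong[OF eq, of m] by auto
qed auto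

lemma sum_tensor_index:
  assumes "m < r"
  shows "(\<Sum>k\<in>tensor_index r p. f k) = (\<Sum>s<p m. \<Sum>i\<in>off_index r p m. f (i(m := s)))"
proof -
  have "insert m ({..<r} - {m}) = {..<r}"
    using assms by auto
  thus ?thesis
    using sum_PiE_insert[of m "{..<r} - {m}" f "\<lambda>j. {..<p j}"] by (simp add: tensor_index_def)
qed

text \<open>The invariant of the left-to-right product: after n modes the entries below n have been
  summed over, so \<open>A\<close> is read at \<open>k\<close> there and still at \<open>j\<close>
  beyond. The index \<open>j\<close> stays arbitrary because the step evaluates the shorter product
  at \<open>j(n := c)\<close>; reading the ranges off \<open>dim_col\<close> keeps dimension
  hypotheses out of the induction.\<close>

lemma all_modes_prod_eq_sum_PiE:
  "all_modes_prod n A B j =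
    (\<Sum>k\<in>(\<Pi>\<^sub>E m\<in>{..<n}. {..<dim_col (B m)}).
      A (\<lambda>i. if i < n then k i else j i) * (\<Prod>m<n. B m $$ (j m, k m)))"
proof (induction n arbitrary: j)
  case 0
  show ?case by (simp add: all_modes_prod_def)
next
  case (Suc n)
  let ?P = "\<Pi>\<^sub>E m\<in>{..<n}. {..<dim_col (B m)}"
  have "all_modes_prod (Suc n) A B j =
      (\<Sum>c<dim_col (B n). all_modes_prod n A B (j(n := c)) * B n $$ (j n, c))"
    by (simp add: all_modes_prod_def mode_prod_def)
  also have "\<dots> = (\<Sum>c<dim_col (B n). \<Sum>k\<in>?P.
      A (\<lambda>i. if i < n then k i else (j(n := c)) i) *
      (\<Prod>m<n. B m $$ ((j(n := c)) m, k m)) * B n $$ (j n, c))"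
    by (simp only: Suc.IH sum_distrib_right)
  also have "\<dots> = (\<Sum>c<dim_col (B n). \<Sum>k\<in>?P.
      A (\<lambda>i. if i < Suc n then (k(n := c)) i else j i) *
      (\<Prod>m<Suc n. B m $$ (j m, (k(n := c)) m)))"
  proof (intro sum.cong refl)
    fix c k
    have "(\<lambda>i. if i < n then k i else (j(n := c)) i) =
        (\<lambda>i. if i < Suc n then (k(n := c)) i else j i)"
      by (auto simp: fun_eq_iff less_Suc_eq)
    moreover have "(\<Prod>m<n. B m $$ ((j(n := c)) m, k m)) = (\<Prod>m<n. B m $$ (j m, (k(n := c)) m))"
      by (intro prod.cong) auto
    ultimately show "A (\<lambda>i. if i < n then k i else (j(n := c)) i) *
        (\<Prod>m<n. B m $$ ((j(n := c)) m, k m)) * B n $$ (j n, c) =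
        A (\<lambda>i. if i < Suc n then (k(n := c)) i else j i) *
        (\<Prod>m<Suc n. B m $$ (j m, (k(n := c)) m))"
      by simp
  qed
  also have "\<dots> = (\<Sum>k\<in>(\<Pi>\<^sub>E m\<in>{..<Suc n}. {..<dim_col (B m)}).
      A (\<lambda>i. if i < Suc n then k i else j i) * (\<Prod>m<Suc n. B m $$ (j m, k m)))"
    using sum_PiE_insert[of n "{..<n}"
        "\<lambda>k. A (\<lambda>i. if i < Suc n then k i else j i) * (\<Prod>m<Suc n. B m $$ (j m, k m))"
        "\<lambda>m. {..<dim_col (B m)}"]
    by (simp only: lessThan_Suc lessThan_iff less_irrefl not_False_eq_True)
  finally show ?case .
qed

lemma all_modes_prod_eq:
  assumes "\<And>m. m < r \<Longrightarrow> dim_col (B m) = p m" and "j \<in> tensor_index r p"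
  shows "all_modes_prod r A B j = (\<Sum>k\<in>tensor_index r p. A k * (\<Prod>m<r. B m $$ (j m, k m)))"
proof -
  have "(\<Pi>\<^sub>E m\<in>{..<r}. {..<dim_col (B m)}) = tensor_index r p"
    unfolding tensor_index_def using assms(1) by (intro PiE_cong) auto
  \<comment> \<open>From \<open>r\<close> on, \<open>j\<close> and \<open>k\<close> are both
    \<open>undefined\<close>, so the mixed index is \<open>k\<close> itself.\<close>
  moreover have "(\<lambda>i. if i < r then k i else j i) = k" if "k \<in> tensor_index r p" for k
    using that assms(2) by (auto simp: fun_eq_iff tensor_index_def PiE_iff extensional_def)
  ultimately show ?thesis
    unfolding all_modes_prod_eq_sum_PiE by (intro sum.cong) auto
qed

text \<open>\<open>A'\<close> is only prescribed on valid multi-indices because the model determines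
  the observed tensor only there.\<close>

lemma all_modes_prod_comp:
  assumes B: "\<And>m. m < r \<Longrightarrow> B m \<in> carrier_mat (p m) (p m)"
    and C: "\<And>m. m < r \<Longrightarrow> C m \<in> carrier_mat (p m) (p m)"
    and A': "\<And>i. i \<in> tensor_index r p \<Longrightarrow> A' i = all_modes_prod r A B i"
    and j: "j \<in> tensor_index r p"
  shows "all_modes_prod r A' C j = all_modes_prod r A (\<lambda>m. C m * B m) j"
proof -
  let ?T = "tensor_index r p"
  have dims: "dim_col (B m) = p m" "dim_col (C m) = p m" "dim_col (C m * B m) = p m" if "m < r" for m
    using B[OF that] C[OF that] by auto
  have "all_modes_prod r A' C j = (\<Sum>k\<in>?T. A' k * (\<Prod>m<r. C m $$ (j m, k m)))"
    using dims j by (intro all_modes_prod_eq) auto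
  also have "\<dots> = (\<Sum>k\<in>?T. \<Sum>l\<in>?T. A l * (\<Prod>m<r. C m $$ (j m, k m) * B m $$ (k m, l m)))"
    using dims by (intro sum.cong refl)
      (simp add: A' all_modes_prod_eq[where B = B and p = p] sum_distrib_left sum_distrib_right
        prod.distrib mult_ac)
  also have "\<dots> = (\<Sum>l\<in>?T. A l * (\<Sum>k\<in>?T. \<Prod>m<r. C m $$ (j m, k m) * B m $$ (k m, l m)))"
    by (subst sum.swap) (simp add: sum_distrib_left)
  \<comment> \<open>Distributivity: the sum over all intermediate multi-indices of a product over
    modes is a product of sums, one matrix product entry per mode.\<close>
  also have "\<dots> = (\<Sum>l\<in>?T. A l * (\<Prod>m<r. \<Sum>x<p m. C m $$ (j m, x) * B m $$ (x, l m)))"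
    by (simp add: tensor_index_def prod_sum_PiE)
  also have "\<dots> = (\<Sum>l\<in>?T. A l * (\<Prod>m<r. (C m * B m) $$ (j m, l m)))"
  proof (intro sum.cong refl arg_cong2[where f = "(*)"] prod.cong)
    fix l m assume "l \<in> ?T" "m \<in> {..<r}"
    thus "(\<Sum>x<p m. C m $$ (j m, x) * B m $$ (x, l m)) = (C m * B m) $$ (j m, l m)"
      using index_mult_mat_sum[OF C B, of m "j m" "l m"] j by (auto simp: tensor_index_def PiE_iff)
  qed
  also have "\<dots> = all_modes_prod r A (\<lambda>m. C m * B m) j"
    using dims j by (intro all_modes_prod_eq[symmetric]) auto
  finally show ?thesis .
qed

lemma all_modes_prod_smult:
  assumes W: "\<And>m. m < r \<Longrightarrow> W m \<in> carrier_mat (p m) (p m)"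
    and B: "\<And>m. m < r \<Longrightarrow> B m = c m \<cdot>\<^sub>m W m"
    and j: "j \<in> tensor_index r p"
  shows "all_modes_prod r A B j = (\<Prod>m<r. c m) * all_modes_prod r A W j"
proof -
  have B': "dim_col (B m) = p m" if "m < r" for m
    using W[OF that] B[OF that] by auto
  have BW: "B m $$ (a, b) = c m * W m $$ (a, b)" if "m < r" "a < p m" "b < p m" for m a b
    using W[OF that(1)] B[OF that(1)] that by auto
  have "all_modes_prod r A B j = (\<Sum>k\<in>tensor_index r p. A k * (\<Prod>m<r. c m * W m $$ (j m, k m)))"
    using j
    by (subst all_modes_prod_eq[where p = p, OF B' j])
      (auto simp: tensor_index_def PiE_iff BW intro!: sum.cong prod.cong)
  also have "\<dots> = (\<Prod>m<r. c m) * all_modes_prod r A W j"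
    using W j by (subst all_modes_prod_eq[where p = p]) (auto simp: prod.distrib sum_distrib_left mult_ac)
  finally show ?thesis .
qed

section \<open>Products over all modes but one\<close>

lemma mode_inner_cong:
  assumes "m < r" "\<And>i. i \<in> tensor_index r p \<Longrightarrow> A i = A' i"
  shows "mode_inner r p m A A = mode_inner r p m A' A'"
  unfolding mode_inner_def using assms
  by (intro cong_mat) (auto intro!: sum.cong simp: fun_upd_off_index)

lemma mode_inner_carrier: "mode_inner r p m A B \<in> carrier_mat (p m) (p m)"
  by (simp add: mode_inner_def)

lemma mode_inner_smult:
  "mode_inner r p m (\<lambda>i. c * A i) (\<lambda>i. c * A i) = c\<^sup>2 \<cdot>\<^sub>m mode_inner r p m A A"
  by (auto simp: mode_inner_def sum_distrib_left power2_eq_square mult_ac intro!: eq_matI sum.cong)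

text \<open>The summation index enters only through the entries of \<open>B j\<close> with j
  \<noteq> m, so summing over it first leaves a product of entries of the Gram matrices
  \<open>(B j)\<^sup>T * B j\<close>. The same expansion serves twice: for orthonormal factors,
  where these entries are deltas, and for \<open>\<Omega>\<close>, where the second moments make
  \<open>k\<close> and \<open>l\<close> equal.\<close>

lemma mode_inner_all_modes_prod:
  assumes m: "m < r" and B: "\<And>j. j < r \<Longrightarrow> B j \<in> carrier_mat (p j) (p j)"
    and st: "s < p m" "t < p m"
  shows "mode_inner r p m (all_modes_prod r A B) (all_modes_prod r A B) $$ (s, t) =
    (\<Sum>k\<in>tensor_index r p. \<Sum>l\<in>tensor_index r p. A k * A l * (B m $$ (s, k m) * B m $$ (t, l m) *
      (\<Prod>j\<in>{..<r} - {m}. \<Sum>x<p j. B j $$ (x, k j) * B j $$ (x, l j))))"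
proof -
  let ?T = "tensor_index r p" and ?R = "{..<r} - {m}"
  have dims: "dim_col (B j) = p j" if "j < r" for j
    using B[OF that] by auto
  have ex: "all_modes_prod r A B (i(m := u)) =
      (\<Sum>k\<in>?T. A k * (B m $$ (u, k m) * (\<Prod>j\<in>?R. B j $$ (i j, k j))))"
    if "i \<in> off_index r p m" "u < p m" for i u
  proof -
    have "all_modes_prod r A B (i(m := u)) = (\<Sum>k\<in>?T. A k * (\<Prod>j<r. B j $$ ((i(m := u)) j, k j)))"
      using dims fun_upd_off_index[OF m that] by (rule all_modes_prod_eq)
    moreover have "(\<Prod>j<r. B j $$ ((i(m := u)) j, k j)) =
        B m $$ (u, k m) * (\<Prod>j\<in>?R. B j $$ (i j, k j))" for k
      using m by (simp add: prod.remove[of "{..<r}" m])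
    ultimately show ?thesis
      by simp
  qed
  have "mode_inner r p m (all_modes_prod r A B) (all_modes_prod r A B) $$ (s, t) =
    (\<Sum>i\<in>off_index r p m. \<Sum>k\<in>?T. \<Sum>l\<in>?T. A k * A l * (B m $$ (s, k m) * B m $$ (t, l m) *
      (\<Prod>j\<in>?R. B j $$ (i j, k j) * B j $$ (i j, l j))))"
    using st by (simp add: mode_inner_def ex sum_product prod.distrib mult_ac)
  also have "\<dots> = (\<Sum>k\<in>?T. \<Sum>l\<in>?T. \<Sum>i\<in>off_index r p m. A k * A l * (B m $$ (s, k m) * B m $$ (t, l m) *
      (\<Prod>j\<in>?R. B j $$ (i j, k j) * B j $$ (i j, l j))))"
    by (subst sum.swap, subst sum.swap[of _ "off_index r p m"], rule refl)
  also have "\<dots> = (\<Sum>k\<in>?T. \<Sum>l\<in>?T. A k * A l * (B m $$ (s, k m) * B m $$ (t, l m) *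
      (\<Sum>i\<in>off_index r p m. \<Prod>j\<in>?R. B j $$ (i j, k j) * B j $$ (i j, l j))))"
    by (simp add: sum_distrib_left)
  finally show ?thesis
    by (subst prod_sum_PiE) simp_all
qed

text \<open>The Gram entries are Kronecker deltas, and their product over the modes other than
  \<open>m\<close> forces the two multi-indices to agree off \<open>m\<close>. What survives is an
  inner product of two faces of \<open>A\<close>, weighted by \<open>W m\<close> on both
  sides.\<close>

lemma mode_inner_orthonormal:
  assumes m: "m < r" and W: "\<And>j. j < r \<Longrightarrow> orthonormal_mat (p j) (W j)"
  shows "mode_inner r p m (all_modes_prod r A W) (all_modes_prod r A W) =
    W m * mode_inner r p m A A * (W m)\<^sup>T" (is "?L = ?R")
proof -
  let ?N = "mode_inner r p m A A" and ?O = "off_index r p m"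
  have carr: "W j \<in> carrier_mat (p j) (p j)" if "j < r" for j
    using W[OF that] by (simp add: orthonormal_mat_def)
  note Wm = carr[OF m]
  have orth: "(\<Sum>x<p j. W j $$ (x, k) * W j $$ (x, l)) = of_bool (k = l)"
    if "j < r" "k < p j" "l < p j" for j k l
  proof -
    have "((W j)\<^sup>T * W j) $$ (k, l) = (\<Sum>x<p j. W j $$ (x, k) * W j $$ (x, l))"
      using carr[OF that(1)] that by (subst index_mult_mat_sum[of _ "p j" "p j" _ "p j"]) auto
    thus ?thesis
      using W[OF that(1)] that by (simp add: orthonormal_mat_def of_bool_def split: if_splits)
  qed
  have "?L $$ (s, t) = ?R $$ (s, t)" if st: "s < p m" "t < p m" for s t
  proof -
    have delta: "(\<Prod>j\<in>{..<r} - {m}. \<Sum>x<p j. W j $$ (x, i j) * W j $$ (x, k j)) = of_bool (i = k)"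
      if "i \<in> ?O" "k \<in> ?O" for i k
    proof -
      have "(\<Prod>j\<in>{..<r} - {m}. \<Sum>x<p j. W j $$ (x, i j) * W j $$ (x, k j)) =
          (\<Prod>j\<in>{..<r} - {m}. of_bool (i j = k j))"
        using that by (intro prod.cong refl orth) (auto simp: PiE_iff)
      also have "\<dots> = of_bool (\<forall>j\<in>{..<r} - {m}. i j = k j)"
        by (auto simp: of_bool_def intro!: prod.neutral)
      also have "(\<forall>j\<in>{..<r} - {m}. i j = k j) \<longleftrightarrow> i = k"
        using that PiE_ext[of i "{..<r} - {m}" "\<lambda>j. {..<p j}" k] by blast
      finally show ?thesis .
    qed
    have upd: "(\<Prod>j\<in>{..<r} - {m}. \<Sum>x<p j. W j $$ (x, (i(m := a)) j) * W j $$ (x, (k(m := b)) j)) =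
       (\<Prod>j\<in>{..<r} - {m}. \<Sum>x<p j. W j $$ (x, i j) * W j $$ (x, k j))" for i k a b
      by (intro prod.cong) auto
    have "?L $$ (s, t) = (\<Sum>a<p m. \<Sum>i\<in>?O. \<Sum>b<p m. \<Sum>k\<in>?O. A (i(m := a)) * A (k(m := b)) *
        (W m $$ (s, a) * W m $$ (t, b) * of_bool (i = k)))"
      by (subst mode_inner_all_modes_prod[where p = p, OF m carr st], assumption)
        (simp add: sum_tensor_index[OF m] upd delta del: sum_mult_of_bool_eq sum_of_bool_eq)
    also have "\<dots> = (\<Sum>a<p m. \<Sum>i\<in>?O. \<Sum>b<p m. A (i(m := a)) * A (i(m := b)) *
        (W m $$ (s, a) * W m $$ (t, b)))"
      by (intro sum.cong refl) (simp add: of_bool_def if_distrib finite_off_index cong: if_cong)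
    also have "\<dots> = (\<Sum>a<p m. \<Sum>b<p m. \<Sum>i\<in>?O. A (i(m := a)) * A (i(m := b)) *
        (W m $$ (s, a) * W m $$ (t, b)))"
      by (intro sum.cong refl sum.swap)
    also have "\<dots> = (\<Sum>a<p m. \<Sum>b<p m. W m $$ (s, a) * ?N $$ (a, b) * W m $$ (t, b))"
      by (simp add: mode_inner_def sum_distrib_left sum_distrib_right mult_ac)
    also have "\<dots> = (\<Sum>b<p m. (\<Sum>a<p m. W m $$ (s, a) * ?N $$ (a, b)) * W m $$ (t, b))"
      by (subst sum.swap) (simp add: sum_distrib_right)
    also have "\<dots> = (\<Sum>b<p m. (W m * ?N) $$ (s, b) * (W m)\<^sup>T $$ (b, t))"
      using Wm st by (intro sum.cong refl arg_cong2[where f = "(*)"])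
        (auto simp: index_mult_mat_sum[OF Wm mode_inner_carrier[of r p m A A]] simp del: index_mult_mat(1))
    also have "\<dots> = ?R $$ (s, t)"
      using Wm st mode_inner_carrier[of r p m A A]
      by (subst index_mult_mat_sum[of _ "p m" "p m" _ "p m"]) auto
    finally show ?thesis .
  qed
  thus ?thesis
    using Wm by (intro eq_matI) (simp_all del: index_mult_mat(1) add: mode_inner_def)
qed

section \<open>Matrix identities\<close>

lemma index_conj_mat:
  assumes "W \<in> carrier_mat n n" "F \<in> carrier_mat n n" "s < n" "t < n"
  shows "(W * F * W\<^sup>T) $$ (s, t) = (\<Sum>b<n. \<Sum>a<n. W $$ (s, a) * F $$ (a, b) * W $$ (t, b))"
proof -
  have "(W * F * W\<^sup>T) $$ (s, t) = (\<Sum>b<n. (W * F) $$ (s, b) * W\<^sup>T $$ (b, t))"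
    using assms by (intro index_mult_mat_sum[of _ n n _ n]) auto
  also have "\<dots> = (\<Sum>b<n. \<Sum>a<n. W $$ (s, a) * F $$ (a, b) * W $$ (t, b))"
    using assms by (intro sum.cong refl)
      (simp add: index_mult_mat_sum[OF assms(1,2)] sum_distrib_right del: index_mult_mat(1))
  finally show ?thesis .
qed

lemma sum_diag_mult_commute:
  fixes A B :: "'a :: comm_semiring_0 mat"
  assumes "A \<in> carrier_mat n n" "B \<in> carrier_mat n n"
  shows "(\<Sum>s<n. (A * B) $$ (s, s)) = (\<Sum>s<n. (B * A) $$ (s, s))"
proof -
  have "(\<Sum>s<n. (A * B) $$ (s, s)) = (\<Sum>s<n. \<Sum>x<n. A $$ (s, x) * B $$ (x, s))"
    using assms by (intro sum.cong index_mult_mat_sum) auto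
  also have "\<dots> = (\<Sum>x<n. \<Sum>s<n. B $$ (x, s) * A $$ (s, x))"
    by (subst sum.swap) (simp add: mult.commute)
  also have "\<dots> = (\<Sum>x<n. (B * A) $$ (x, x))"
    using assms by (intro sum.cong index_mult_mat_sum[symmetric]) auto
  finally show ?thesis .
qed

lemma orthonormal_mat_mult_transpose:
  assumes "orthonormal_mat n Q" "orthonormal_mat n R"
  shows "orthonormal_mat n (Q * R\<^sup>T)"
proof -
  note [simp] = assoc_mult_mat[of _ n n _ n _ n]
  have c: "Q \<in> carrier_mat n n" "R \<in> carrier_mat n n" "Q\<^sup>T \<in> carrier_mat n n" "R\<^sup>T \<in> carrier_mat n n"
    using assms by (auto simp: orthonormal_mat_def)
  have T: "(Q * R\<^sup>T)\<^sup>T = R * Q\<^sup>T"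
    using c by (simp add: transpose_mult[of _ n n _ n])
  have "(Q * R\<^sup>T) * (R * Q\<^sup>T) = Q * ((R\<^sup>T * R) * Q\<^sup>T)"
    "(R * Q\<^sup>T) * (Q * R\<^sup>T) = R * ((Q\<^sup>T * Q) * R\<^sup>T)"
    using c by simp_all
  moreover have "Q * ((R\<^sup>T * R) * Q\<^sup>T) = 1\<^sub>m n" "R * ((Q\<^sup>T * Q) * R\<^sup>T) = 1\<^sub>m n"
    using assms c by (simp_all add: orthonormal_mat_def left_mult_one_mat[of _ n n] del: assoc_mult_mat)
  ultimately show ?thesis
    using c by (simp only: orthonormal_mat_def T mult_carrier_mat[of _ n n])
qed

text \<open>Invariance of the trace, by cyclicity. Squared Frobenius norms, of matrices and of
  tensors alike, are traces, so this makes them insensitive to rotations.\<close>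

lemma sum_diag_conj_orthonormal:
  assumes W: "orthonormal_mat n W" and N: "N \<in> carrier_mat n n"
  shows "(\<Sum>s<n. (W * N * W\<^sup>T) $$ (s, s)) = (\<Sum>s<n. N $$ (s, s))"
proof -
  have c: "W \<in> carrier_mat n n" "W\<^sup>T \<in> carrier_mat n n" and 1: "W\<^sup>T * W = 1\<^sub>m n"
    using W by (auto simp: orthonormal_mat_def)
  have "(\<Sum>s<n. (W * N * W\<^sup>T) $$ (s, s)) = (\<Sum>s<n. (W\<^sup>T * (W * N)) $$ (s, s))"
    using c N by (intro sum_diag_mult_commute) auto
  also have "W\<^sup>T * (W * N) = (W\<^sup>T * W) * N"
    using c N by (simp add: assoc_mult_mat[of _ n n _ n _ n])
  finally show ?thesis
    using N by (simp add: 1 left_mult_one_mat[of _ n n])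
qed

section \<open>Frobenius norm, singular value decomposition and inverse square roots\<close>

lemma mat_fnorm_square:
  assumes "A \<in> carrier_mat n n"
  shows "(mat_fnorm A)\<^sup>2 = (\<Sum>s<n. (A * A\<^sup>T) $$ (s, s))"
proof -
  have "(A * A\<^sup>T) $$ (s, s) = (\<Sum>x<n. (A $$ (s, x))\<^sup>2)" if "s < n" for s
    using assms that by (subst index_mult_mat_sum[of _ n n _ n]) (auto simp: power2_eq_square)
  thus ?thesis
    using assms by (simp add: mat_fnorm_def sum_nonneg)
qed

text \<open>The right singular vectors cancel, so the covariance cannot see them; this is why they
  remain in the final matrices \<open>W\<close>.\<close>

lemma is_svd_mult_transpose:
  assumes "is_svd n A U D V"
  shows "A \<in> carrier_mat n n" and "A * A\<^sup>T = U * (D * D\<^sup>T) * U\<^sup>T"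
proof -
  note [simp] = assoc_mult_mat[of _ n n _ n _ n]
  have c: "U \<in> carrier_mat n n" "D \<in> carrier_mat n n" "V \<in> carrier_mat n n"
    "U\<^sup>T \<in> carrier_mat n n" "D\<^sup>T \<in> carrier_mat n n" "V\<^sup>T \<in> carrier_mat n n"
    and A: "A = U * D * V\<^sup>T" and VV: "V\<^sup>T * V = 1\<^sub>m n"
    using assms by (auto simp: is_svd_def orthonormal_mat_def)
  show "A \<in> carrier_mat n n"
    using A c by auto
  have "A\<^sup>T = V * (D\<^sup>T * U\<^sup>T)"
    unfolding A using c by (simp add: transpose_mult[of _ n n _ n])
  hence "A * A\<^sup>T = U * (D * ((V\<^sup>T * V) * (D\<^sup>T * U\<^sup>T)))"
    using c by (simp add: A)
  thus "A * A\<^sup>T = U * (D * D\<^sup>T) * U\<^sup>T"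
    using c by (simp add: VV left_mult_one_mat[of _ n n])
qed

lemma is_svd_fnorm:
  assumes "is_svd n A U D V"
  shows "mat_fnorm A = mat_fnorm D"
proof -
  have D: "D \<in> carrier_mat n n" and U: "orthonormal_mat n U"
    using assms by (auto simp: is_svd_def)
  have "(mat_fnorm A)\<^sup>2 = (mat_fnorm D)\<^sup>2"
    using is_svd_mult_transpose[OF assms] D
    by (simp add: mat_fnorm_square[of _ n] sum_diag_conj_orthonormal[OF U] del: index_mult_mat(1))
  thus ?thesis
    by (simp add: mat_fnorm_def sum_nonneg)
qed

text \<open>The reciprocals of the positive diagonal entries form a two-sided inverse, which makes
  \<open>D\<close> a unit of the matrix ring. This rules out \<open>None\<close>, so
  \<open>the\<close> yields a genuine inverse.\<close>

lemma is_svd_inverse: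
  assumes "is_svd n A U D V"
  shows "the (mat_inverse D) \<in> carrier_mat n n"
    and "D * the (mat_inverse D) = 1\<^sub>m n" and "the (mat_inverse D) * D = 1\<^sub>m n"
proof -
  have D: "D \<in> carrier_mat n n" "diagonal_mat D" "\<And>i. i < n \<Longrightarrow> D $$ (i, i) > 0"
    using assms by (auto simp: is_svd_def)
  define d where "d = (\<lambda>i. D $$ (i, i))"
  have D_diag: "D = mat_diag n d"
    using D by (intro eq_matI) (auto simp: mat_diag_def d_def diagonal_mat_def)
  have one: "mat_diag n (\<lambda>i. d i * inverse (d i)) = 1\<^sub>m n" "mat_diag n (\<lambda>i. inverse (d i) * d i) = 1\<^sub>m n"
    using D(3) by (auto simp: mat_diag_def d_def intro!: eq_matI) fastforce+
  have "D \<in> Units (ring_mat TYPE(real) n ())"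
    using D(1) one unfolding Units_def ring_mat_def
    by (auto simp: D_diag intro!: bexI[of _ "mat_diag n (\<lambda>i. inverse (d i))"])
  with mat_inverse(1)[OF D(1), where b = "()"] obtain E where E: "mat_inverse D = Some E"
    by blast
  from mat_inverse(2)[OF D(1) E] E show "the (mat_inverse D) \<in> carrier_mat n n"
    and "D * the (mat_inverse D) = 1\<^sub>m n" and "the (mat_inverse D) * D = 1\<^sub>m n"
    by auto
qed

lemma smult_smult_mat:
  fixes A :: "'a :: semigroup_mult mat"
  shows "a \<cdot>\<^sub>m (b \<cdot>\<^sub>m A) = (a * b) \<cdot>\<^sub>m A"
  by (intro eq_matI) (auto simp: mult.assoc)

lemma one_smult_mat:
  fixes A :: "'a :: monoid_mult mat"
  shows "1 \<cdot>\<^sub>m A = A"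
  by (intro eq_matI) auto

text \<open>Meant for c = \<open>mode_scale\<close>, where the scaled \<open>A * A\<^sup>T\<close>
  is the covariance of one mode: every inverse square root then has exactly one orthogonal
  factor.\<close>

lemma inverse_sqrt_orthogonal_factor:
  assumes svd: "is_svd n A U D V" and c: "c \<noteq> 0"
    and G: "inverse_sqrt_of n (inverse (c\<^sup>2) \<cdot>\<^sub>m (A * A\<^sup>T)) G"
  shows "\<exists>!Q. orthonormal_mat n Q \<and> G = c \<cdot>\<^sub>m (Q * the (mat_inverse D) * U\<^sup>T)"
proof -
  note [simp] = assoc_mult_mat[of _ n n _ n _ n] mult_smult_distrib[of _ n n _ n]
    mult_smult_assoc_mat[of _ n n _ n] transpose_mult[of _ n n _ n]
    left_mult_one_mat[of _ n n] right_mult_one_mat[of _ n n]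
  define E where "E = the (mat_inverse D)"
  have cU: "U \<in> carrier_mat n n" "U\<^sup>T \<in> carrier_mat n n" and UU: "U\<^sup>T * U = 1\<^sub>m n" "U * U\<^sup>T = 1\<^sub>m n"
    and cD: "D \<in> carrier_mat n n" "D\<^sup>T \<in> carrier_mat n n"
    using svd by (auto simp: is_svd_def orthonormal_mat_def)
  have cE: "E \<in> carrier_mat n n" and DE: "D * E = 1\<^sub>m n" "E * D = 1\<^sub>m n"
    using is_svd_inverse[OF svd] by (auto simp: E_def)
  have cG: "G \<in> carrier_mat n n" "G\<^sup>T \<in> carrier_mat n n"
    and GSG: "G * (inverse (c\<^sup>2) \<cdot>\<^sub>m (A * A\<^sup>T)) * G\<^sup>T = 1\<^sub>m n"
    using G by (auto simp: inverse_sqrt_of_def)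
  note carr = cU cD cE cG
  \<comment> \<open>The only candidate, obtained by solving
    \<open>G = c \<cdot>\<^sub>m (Q * E * U\<^sup>T)\<close> for \<open>Q\<close>; uniqueness below
    is the same calculation.\<close>
  define Q where "Q = inverse c \<cdot>\<^sub>m (G * U * D)"
  have cQ: "Q \<in> carrier_mat n n" "Q\<^sup>T \<in> carrier_mat n n"
    using carr by (auto simp: Q_def)
  have QT: "Q\<^sup>T = inverse c \<cdot>\<^sub>m (D\<^sup>T * (U\<^sup>T * G\<^sup>T))"
  proof -
    have "(k \<cdot>\<^sub>m B)\<^sup>T = k \<cdot>\<^sub>m B\<^sup>T" for k :: real and B
      by (intro eq_matI) auto
    thus ?thesis
      using carr by (simp add: Q_def)
  qed
  \<comment> \<open>The inner factor is \<open>A * A\<^sup>T\<close>, so orthogonality of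
    \<open>Q\<close> is the defining equation of the inverse square root.\<close>
  have "Q * Q\<^sup>T = inverse (c\<^sup>2) \<cdot>\<^sub>m (G * (U * (D * D\<^sup>T) * U\<^sup>T) * G\<^sup>T)"
    unfolding QT unfolding Q_def using carr
    by (simp add: smult_smult_mat power2_eq_square del: index_mult_mat)
  also have "\<dots> = 1\<^sub>m n"
    using GSG carr unfolding is_svd_mult_transpose(2)[OF svd] by simp
  finally have QQ: "Q * Q\<^sup>T = 1\<^sub>m n" .
  moreover have "Q\<^sup>T * Q = 1\<^sub>m n"
    using mat_mult_left_right_inverse[OF cQ QQ] .
  ultimately have orth: "orthonormal_mat n Q"
    using cQ by (simp add: orthonormal_mat_def)
  have "c \<cdot>\<^sub>m (Q * E * U\<^sup>T) = (c * inverse c) \<cdot>\<^sub>m (G * (U * ((D * E) * U\<^sup>T)))"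
    unfolding Q_def using carr by (simp add: smult_smult_mat)
  also have "\<dots> = G"
    using c carr by (simp add: DE UU one_smult_mat)
  finally have "G = c \<cdot>\<^sub>m (Q * E * U\<^sup>T)" ..
  moreover have "R = Q" if R: "orthonormal_mat n R" "G = c \<cdot>\<^sub>m (R * E * U\<^sup>T)" for R
  proof -
    have cR: "R \<in> carrier_mat n n"
      using R by (simp add: orthonormal_mat_def)
    have "Q = (inverse c * c) \<cdot>\<^sub>m (R * (E * ((U\<^sup>T * U) * D)))"
      unfolding Q_def R(2) using carr cR by (simp add: smult_smult_mat)
    thus "R = Q"
      using carr cR c by (simp add: UU DE one_smult_mat)
  qed
  ultimately show ?thesis
    using orth unfolding E_def by blast
qed

section \<open>Joint moments\<close>

lemma (in prob_space) expectation_prod_powers: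
  fixes X :: "'i \<Rightarrow> 'a \<Rightarrow> real"
  assumes I: "finite I" and indep: "indep_vars (\<lambda>_. borel) X I"
    and int: "\<And>i. i \<in> I \<Longrightarrow> integrable M (\<lambda>\<omega>. X i \<omega> ^ n i)"
  shows "integrable M (\<lambda>\<omega>. \<Prod>i\<in>I. X i \<omega> ^ n i)"
    and "expectation (\<lambda>\<omega>. \<Prod>i\<in>I. X i \<omega> ^ n i) = (\<Prod>i\<in>I. expectation (\<lambda>\<omega>. X i \<omega> ^ n i))"
proof -
  have "indep_vars (\<lambda>_. borel) (\<lambda>i \<omega>. X i \<omega> ^ n i) I"
    by (rule indep_vars_compose2[OF indep]) simp
  with I int show "integrable M (\<lambda>\<omega>. \<Prod>i\<in>I. X i \<omega> ^ n i)"
    and "expectation (\<lambda>\<omega>. \<Prod>i\<in>I. X i \<omega> ^ n i) = (\<Prod>i\<in>I. expectation (\<lambda>\<omega>. X i \<omega> ^ n i))"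
    by (simp_all add: indep_vars_integrable indep_vars_lebesgue_integral)
qed

text \<open>A power up to the fourth is at most 1 when \<bar>y\<bar> \<le> 1 and at most y^4
  otherwise; the constant 1 is integrable since the total mass is finite.\<close>

lemma (in prob_space) integrable_power_le:
  fixes Y :: "'a \<Rightarrow> real"
  assumes [measurable]: "Y \<in> borel_measurable M" and "integrable M (\<lambda>\<omega>. Y \<omega> ^ 4)" and "n \<le> 4"
  shows "integrable M (\<lambda>\<omega>. Y \<omega> ^ n)"
proof (rule Bochner_Integration.integrable_bound[where f = "\<lambda>\<omega>. 1 + Y \<omega> ^ 4"])
  show "integrable M (\<lambda>\<omega>. 1 + Y \<omega> ^ 4)"
    using assms by simp
  have "\<bar>y\<bar> ^ n \<le> 1 + y ^ 4" for y :: real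
  proof (cases "\<bar>y\<bar> \<le> 1")
    case True
    hence "\<bar>y\<bar> ^ n \<le> 1"
      by (simp add: power_le_one)
    moreover have "0 \<le> y ^ 4"
      by simp
    ultimately show ?thesis
      by linarith
  next
    case False
    hence "\<bar>y\<bar> ^ n \<le> \<bar>y\<bar> ^ 4"
      using assms(3) by (intro power_increasing) auto
    thus ?thesis
      by simp
  qed
  thus "AE \<omega> in M. norm (Y \<omega> ^ n) \<le> norm (1 + Y \<omega> ^ 4)"
    by (simp add: power_abs)
qed measurable

locale standardized_family = prob_space M for M :: "'a measure" +
  fixes X :: "'i \<Rightarrow> 'a \<Rightarrow> real" and I :: "'i set"
  assumes finite_I: "finite I"
    and indep: "indep_vars (\<lambda>_. borel) X I"
    and mean: "\<And>i. i \<in> I \<Longrightarrow> expectation (X i) = 0"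
    and second_moment: "\<And>i. i \<in> I \<Longrightarrow> expectation (\<lambda>\<omega>. (X i \<omega>)\<^sup>2) = 1"
    and fourth_moment: "\<And>i. i \<in> I \<Longrightarrow> integrable M (\<lambda>\<omega>. X i \<omega> ^ 4)"
begin

lemma integrable_power:
  assumes "i \<in> I" "n \<le> 4"
  shows "integrable M (\<lambda>\<omega>. X i \<omega> ^ n)"
proof (rule integrable_power_le)
  show "X i \<in> borel_measurable M"
    using indep assms(1) unfolding indep_vars_def by blast
qed (use assms fourth_moment in auto)

text \<open>Independence applies to distinct variables, whereas a, b, c, d may coincide. Letting
  \<open>n i\<close> count the occurrences of \<open>i\<close> turns the product into powers of
  distinct variables and covers all coincidence patterns at once.\<close>

lemma fourth_order_moment:
  assumes abcd: "a \<in> I" "b \<in> I" "c \<in> I" "d \<in> I"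
  defines "n \<equiv> \<lambda>i. of_bool (i = a) + of_bool (i = b) + of_bool (i = c) + of_bool (i = d)"
  shows "integrable M (\<lambda>\<omega>. X a \<omega> * X b \<omega> * X c \<omega> * X d \<omega>)"
    and "expectation (\<lambda>\<omega>. X a \<omega> * X b \<omega> * X c \<omega> * X d \<omega>) =
      (\<Prod>i\<in>I. expectation (\<lambda>\<omega>. X i \<omega> ^ n i))"
proof -
  have single: "(\<Prod>i\<in>I. X i \<omega> ^ of_bool (i = e)) = X e \<omega>" if "e \<in> I" for e \<omega>
  proof -
    have "(\<Prod>i\<in>I. X i \<omega> ^ of_bool (i = e)) = (\<Prod>i\<in>I. if i = e then X i \<omega> else 1)"
      by (intro prod.cong) auto
    thus ?thesis
      using finite_I that by simp
  qed
  have eq: "(\<Prod>i\<in>I. X i \<omega> ^ n i) = X a \<omega> * X b \<omega> * X c \<omega> * X d \<omega>" for \<omega>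
    using abcd by (simp add: n_def power_add prod.distrib single)
  have "n i \<le> 4" for i
    by (auto simp: n_def of_bool_def)
  hence "integrable M (\<lambda>\<omega>. X i \<omega> ^ n i)" if "i \<in> I" for i
    using that integrable_power by blast
  from expectation_prod_powers[OF finite_I indep this]
  show "integrable M (\<lambda>\<omega>. X a \<omega> * X b \<omega> * X c \<omega> * X d \<omega>)"
    and "expectation (\<lambda>\<omega>. X a \<omega> * X b \<omega> * X c \<omega> * X d \<omega>) =
      (\<Prod>i\<in>I. expectation (\<lambda>\<omega>. X i \<omega> ^ n i))"
    by (simp_all add: eq)
qed

text \<open>The isolated variable has exponent one, so its factor is a mean, hence zero.\<close>

lemma fourth_order_moment_isolated:
  assumes abcd: "a \<in> I" "b \<in> I" "c \<in> I" "d \<in> I" and "a \<notin> {b, c, d}"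
  shows "expectation (\<lambda>\<omega>. X a \<omega> * X b \<omega> * X c \<omega> * X d \<omega>) = 0"
  unfolding fourth_order_moment(2)[OF abcd]
  using assms finite_I mean[of a] by (intro prod_zero bexI[of _ a]) auto

text \<open>Every exponent is 0 or 2, so each factor is the total mass or a unit second
  moment.\<close>

lemma fourth_order_moment_pairs:
  assumes ab: "a \<in> I" "b \<in> I" and "a \<noteq> b"
  shows "expectation (\<lambda>\<omega>. X a \<omega> * X a \<omega> * X b \<omega> * X b \<omega>) = 1"
  unfolding fourth_order_moment(2)[OF ab(1) ab(1) ab(2) ab(2)]
proof (intro prod.neutral ballI)
  fix i assume "i \<in> I"
  thus "expectation (\<lambda>\<omega>. X i \<omega> ^ (of_bool (i = a) + of_bool (i = a) + of_bool (i = b) + of_bool (i = b))) = 1"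
    using assms second_moment[of i]
    by (cases "i = a"; cases "i = b") (simp_all add: prob_space flip: numeral_2_eq_2)
qed

lemma integrable_mult:
  assumes ab: "a \<in> I" "b \<in> I"
  shows "integrable M (\<lambda>\<omega>. X a \<omega> * X b \<omega>)"
proof (rule Bochner_Integration.integrable_bound[where f = "\<lambda>\<omega>. (X a \<omega>)\<^sup>2 + (X b \<omega>)\<^sup>2"])
  have [measurable]: "X a \<in> borel_measurable M" "X b \<in> borel_measurable M"
    using indep ab unfolding indep_vars_def by blast+
  show "integrable M (\<lambda>\<omega>. (X a \<omega>)\<^sup>2 + (X b \<omega>)\<^sup>2)"
    using ab by (intro Bochner_Integration.integrable_add integrable_power) auto
  show "(\<lambda>\<omega>. X a \<omega> * X b \<omega>) \<in> borel_measurable M"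
    by measurable
  have "\<bar>x * y\<bar> \<le> \<bar>x\<^sup>2 + y\<^sup>2\<bar>" for x y :: real
  proof -
    have "2 * (\<bar>x\<bar> * \<bar>y\<bar>) \<le> x\<^sup>2 + y\<^sup>2"
      using sum_squares_bound[of "\<bar>x\<bar>" "\<bar>y\<bar>"] by (simp add: mult.assoc)
    moreover have "0 \<le> \<bar>x\<bar> * \<bar>y\<bar>"
      by simp
    ultimately show ?thesis
      unfolding abs_mult by linarith
  qed
  thus "AE \<omega> in M. norm (X a \<omega> * X b \<omega>) \<le> norm ((X a \<omega>)\<^sup>2 + (X b \<omega>)\<^sup>2)"
    by simp
qed

lemma second_order_moment:
  assumes ab: "a \<in> I" "b \<in> I"
  shows "expectation (\<lambda>\<omega>. X a \<omega> * X b \<omega>) = of_bool (a = b)"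
proof (cases "a = b")
  case True
  thus ?thesis
    using second_moment[OF ab(1)] by (simp add: power2_eq_square)
next
  case False
  have "indep_vars (\<lambda>_. borel) X {a, b}"
    using ab by (intro indep_vars_subset[OF indep]) auto
  moreover have "integrable M (X i)" if "i \<in> {a, b}" for i
    using integrable_power[of i 1] ab that by auto
  ultimately have "expectation (\<lambda>\<omega>. \<Prod>i\<in>{a, b}. X i \<omega>) = (\<Prod>i\<in>{a, b}. expectation (X i))"
    by (intro indep_vars_lebesgue_integral) auto
  thus ?thesis
    using mean ab False by simp
qed

end

section \<open>Moments of a standardized tensor\<close>

lemma sum_of_bool_eq_mult:
  fixes f :: "'i \<Rightarrow> real"
  assumes "finite A" "k \<in> A"
  shows "(\<Sum>i\<in>A. of_bool (i = k) * f i) = f k"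
  using assms by (simp add: of_bool_def if_distrib[of "\<lambda>x. x * _"] cong: if_cong)

lemma expect_mat_cong:
  assumes "\<And>\<omega>. \<omega> \<in> space P \<Longrightarrow> F \<omega> = F' \<omega>"
  shows "expect_mat P n F = expect_mat P n F'"
  unfolding expect_mat_def using assms
  by (intro cong_mat) (auto intro!: Bochner_Integration.integral_cong)

text \<open>Linearity of the expectation. The integrability hypothesis matters because the integral
  of a non-integrable entry is 0 by convention and need not be additive.\<close>

lemma expect_mat_conj:
  assumes W: "W \<in> carrier_mat n n" and F: "\<And>\<omega>. F \<omega> \<in> carrier_mat n n"
    and int: "\<And>a b. a < n \<Longrightarrow> b < n \<Longrightarrow> integrable P (\<lambda>\<omega>. F \<omega> $$ (a, b))"
  shows "expect_mat P n (\<lambda>\<omega>. c \<cdot>\<^sub>m (W * F \<omega> * W\<^sup>T)) = c \<cdot>\<^sub>m (W * expect_mat P n F * W\<^sup>T)"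
    (is "?L = ?R")
proof (rule eq_matI)
  have E: "expect_mat P n F \<in> carrier_mat n n"
    by (simp add: expect_mat_def)
  fix s t assume "s < dim_row ?R" "t < dim_col ?R"
  hence st: "s < n" "t < n"
    using W by auto
  have "?L $$ (s, t) = (\<integral>\<omega>. c * (W * F \<omega> * W\<^sup>T) $$ (s, t) \<partial>P)"
    using st W F unfolding expect_mat_def by (simp del: index_mult_mat(1))
  also have "\<dots> = (\<integral>\<omega>. c * (\<Sum>b<n. \<Sum>a<n. W $$ (s, a) * F \<omega> $$ (a, b) * W $$ (t, b)) \<partial>P)"
    by (simp only: index_conj_mat[OF W F st])
  also have "\<dots> = c * (\<Sum>b<n. \<Sum>a<n. W $$ (s, a) * (\<integral>\<omega>. F \<omega> $$ (a, b) \<partial>P) * W $$ (t, b))"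
  proof -
    have int': "integrable P (\<lambda>\<omega>. W $$ (s, a) * F \<omega> $$ (a, b) * W $$ (t, b))" if "a < n" "b < n" for a b
      using int[OF that] by simp
    have "(\<integral>\<omega>. (\<Sum>b<n. \<Sum>a<n. W $$ (s, a) * F \<omega> $$ (a, b) * W $$ (t, b)) \<partial>P) =
        (\<Sum>b<n. \<integral>\<omega>. (\<Sum>a<n. W $$ (s, a) * F \<omega> $$ (a, b) * W $$ (t, b)) \<partial>P)"
      by (intro Bochner_Integration.integral_sum Bochner_Integration.integrable_sum int') auto
    also have "\<dots> = (\<Sum>b<n. \<Sum>a<n. \<integral>\<omega>. W $$ (s, a) * F \<omega> $$ (a, b) * W $$ (t, b) \<partial>P)"
      by (intro sum.cong refl Bochner_Integration.integral_sum int') auto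
    finally show ?thesis
      by simp
  qed
  also have "\<dots> = c * (W * expect_mat P n F * W\<^sup>T) $$ (s, t)"
    unfolding index_conj_mat[OF W E st] by (simp add: expect_mat_def)
  finally show "?L $$ (s, t) = ?R $$ (s, t)"
    using st W by simp
qed (use W in \<open>auto simp: expect_mat_def\<close>)

lemma tensor_fnorm_square:
  assumes "m < r"
  shows "(tensor_fnorm r p A)\<^sup>2 = (\<Sum>s<p m. mode_inner r p m A A $$ (s, s))"
  using assms
  by (simp add: tensor_fnorm_def sum_nonneg sum_tensor_index[OF assms] mode_inner_def power2_eq_square)

lemma sum_face:
  assumes "m < r" "k < p m"
  shows "(\<Sum>i\<in>face r p m k. f i) = (\<Sum>i\<in>off_index r p m. f (i(m := k)))"
proof -
  have "(\<Sum>i\<in>face r p m k. f i) = (\<Sum>i\<in>tensor_index r p. if i m = k then f i else 0)"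
    unfolding face_def by (rule sum.inter_filter[OF finite_tensor_index])
  also have "\<dots> = (\<Sum>s<p m. if s = k then \<Sum>i\<in>off_index r p m. f (i(m := s)) else 0)"
    unfolding sum_tensor_index[OF assms(1)] by (intro sum.cong refl) simp
  finally show ?thesis
    using assms(2) by simp
qed

locale standardized_tensor =
  standardized_family M "\<lambda>i \<omega>. Z \<omega> i" "tensor_index r p"
  for M :: "'w measure" and Z :: "'w \<Rightarrow> tensor" and r p
begin

abbreviation "N m \<omega> \<equiv> mode_inner r p m (Z \<omega>) (Z \<omega>)"

text \<open>Uncorrelated entries leave only the terms with equal multi-indices, and these factor
  over the modes: mode \<open>m\<close> contributes \<open>B m * (B m)\<^sup>T\<close>, every other
  mode the sum of its squared column norms. For \<open>\<Omega>\<close> this is the covariance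
  before division by \<rho>.\<close>

lemma expect_mode_inner_all_modes_prod:
  assumes m: "m < r" and B: "\<And>j. j < r \<Longrightarrow> B j \<in> carrier_mat (p j) (p j)"
  shows "expect_mat M (p m) (\<lambda>\<omega>. mode_inner r p m (all_modes_prod r (Z \<omega>) B) (all_modes_prod r (Z \<omega>) B)) =
    (\<Prod>j\<in>{..<r} - {m}. (mat_fnorm (B j))\<^sup>2) \<cdot>\<^sub>m (B m * (B m)\<^sup>T)" (is "?L = ?R")
proof (rule eq_matI)
  let ?T = "tensor_index r p" and ?O = "off_index r p m" and ?J = "{..<r} - {m}"
  fix s t assume "s < dim_row ?R" "t < dim_col ?R"
  hence st: "s < p m" "t < p m"
    using B[OF m] by auto
  define h where "h = (\<lambda>k l. B m $$ (s, k m) * B m $$ (t, l m) *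
      (\<Prod>j\<in>?J. \<Sum>x<p j. B j $$ (x, k j) * B j $$ (x, l j)))"
  have "?L $$ (s, t) = expectation (\<lambda>\<omega>. \<Sum>k\<in>?T. \<Sum>l\<in>?T. Z \<omega> k * Z \<omega> l * h k l)"
    using st by (simp add: expect_mat_def mode_inner_all_modes_prod[where p = p, OF m B st] h_def)
  also have "\<dots> = (\<Sum>k\<in>?T. \<Sum>l\<in>?T. expectation (\<lambda>\<omega>. Z \<omega> k * Z \<omega> l) * h k l)"
    using integrable_mult by (simp add: Bochner_Integration.integral_sum)
  also have "\<dots> = (\<Sum>k\<in>?T. \<Sum>l\<in>?T. if k = l then h k l else 0)"
    by (intro sum.cong refl) (simp add: second_order_moment)
  also have "\<dots> = (\<Sum>k\<in>?T. h k k)"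
    by (simp add: finite_tensor_index)
  also have "\<dots> = (\<Sum>a<p m. \<Sum>i\<in>?O. B m $$ (s, a) * B m $$ (t, a) *
      (\<Prod>j\<in>?J. \<Sum>x<p j. (B j $$ (x, i j))\<^sup>2))"
    unfolding sum_tensor_index[OF m]
    by (intro sum.cong refl) (auto simp: h_def power2_eq_square intro!: prod.cong)
  also have "\<dots> = (\<Sum>a<p m. B m $$ (s, a) * B m $$ (t, a)) *
      (\<Sum>i\<in>?O. \<Prod>j\<in>?J. \<Sum>x<p j. (B j $$ (x, i j))\<^sup>2)"
    by (simp add: sum_product)
  also have "(\<Sum>i\<in>?O. \<Prod>j\<in>?J. \<Sum>x<p j. (B j $$ (x, i j))\<^sup>2) =
      (\<Prod>j\<in>?J. \<Sum>y<p j. \<Sum>x<p j. (B j $$ (x, y))\<^sup>2)"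
    by (subst prod_sum_PiE) simp_all
  also have "\<dots> = (\<Prod>j\<in>?J. (mat_fnorm (B j))\<^sup>2)"
  proof (rule prod.cong)
    fix j assume "j \<in> ?J"
    thus "(\<Sum>y<p j. \<Sum>x<p j. (B j $$ (x, y))\<^sup>2) = (mat_fnorm (B j))\<^sup>2"
      using B[of j] by (subst sum.swap) (simp add: mat_fnorm_def sum_nonneg)
  qed simp
  also have "(\<Sum>a<p m. B m $$ (s, a) * B m $$ (t, a)) = (B m * (B m)\<^sup>T) $$ (s, t)"
    using B[OF m] st by (subst index_mult_mat_sum[of _ "p m" "p m" _ "p m"]) auto
  finally show "?L $$ (s, t) = ?R $$ (s, t)"
    using B[OF m] st by (simp add: mult.commute)
qed (use B[OF m] in \<open>auto simp: expect_mat_def\<close>)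

section \<open>Fourth-order expectations for a fixed mode\<close>

context
  fixes m and \<beta> :: tensor
  assumes m: "m < r" and \<beta>: "\<And>i. i \<in> tensor_index r p \<Longrightarrow> expectation (\<lambda>\<omega>. Z \<omega> i ^ 4) = \<beta> i"
begin

text \<open>For \<open>s = t\<close> the factors pair up along \<open>u = s\<close> or along
  \<open>k = i\<close>. If both hold, all four coincide, and \<open>- 2\<close> corrects the double
  count 1 + 1 to \<beta>. Indicators are used so that the later sums are evaluated linearly.\<close>

lemma expectation_inner_square_term:
  assumes ik: "i \<in> off_index r p m" "k \<in> off_index r p m" and stu: "s < p m" "t < p m" "u < p m"
  shows "expectation (\<lambda>\<omega>. Z \<omega> (i(m := s)) * Z \<omega> (i(m := u)) * Z \<omega> (k(m := u)) * Z \<omega> (k(m := t))) =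
    (if s = t then of_bool (u = s) + of_bool (k = i) * (1 + of_bool (u = s) * (\<beta> (i(m := s)) - 2)) else 0)"
proof -
  note mem = fun_upd_off_index[OF m ik(1)] fun_upd_off_index[OF m ik(2)]
  note eqs = fun_upd_off_index_eq_iff[OF ik] fun_upd_off_index_eq_iff[OF ik(1,1)]
    fun_upd_off_index_eq_iff[OF ik(2,2)] fun_upd_off_index_eq_iff[OF ik(2,1)]
  consider "s \<noteq> t" "u \<noteq> s" | "s \<noteq> t" "u = s" | "s = t" "u = s" "i = k" | "s = t" "u = s" "i \<noteq> k"
    | "s = t" "u \<noteq> s" "i = k" | "s = t" "u \<noteq> s" "i \<noteq> k"
    by blast
  thus ?thesis
  proof cases
    case 1
    thus ?thesis
      using stu fourth_order_moment_isolated[of "i(m := s)" "i(m := u)" "k(m := u)" "k(m := t)"] mem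
      by (simp add: eqs)
  next
    \<comment> \<open>The first two factors now agree, so the last one is the isolated
      factor.\<close>
    case 2
    thus ?thesis
      using stu fourth_order_moment_isolated[of "k(m := t)" "i(m := s)" "i(m := u)" "k(m := u)"] mem
      by (simp add: eqs mult_ac)
  next
    case 3
    thus ?thesis
      using stu \<beta>[of "i(m := s)"] mem by (simp add: power4_eq_xxxx)
  next
    case 4
    thus ?thesis
      using stu fourth_order_moment_pairs[of "i(m := s)" "k(m := s)"] mem
      by (simp add: eqs)
  next
    case 5
    thus ?thesis
      using stu fourth_order_moment_pairs[of "i(m := s)" "i(m := u)"] mem
      by (simp add: eqs mult_ac)
  next
    case 6
    thus ?thesis
      using stu fourth_order_moment_isolated[of "i(m := s)" "i(m := u)" "k(m := u)" "k(m := t)"] mem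
      by (simp add: eqs)
  qed
qed

text \<open>For \<open>s = t\<close> the factors always form two squares, with expectation 1 unless
  both are squares of the same variable; \<open>- 1\<close> trades this generic value for \<beta>
  there.\<close>

lemma expectation_norm_inner_term:
  assumes ik: "i \<in> off_index r p m" "k \<in> off_index r p m" and stu: "s < p m" "t < p m" "u < p m"
  shows "expectation (\<lambda>\<omega>. Z \<omega> (k(m := u)) * Z \<omega> (k(m := u)) * Z \<omega> (i(m := s)) * Z \<omega> (i(m := t))) =
    (if s = t then 1 + of_bool (i = k) * (of_bool (u = s) * (\<beta> (i(m := s)) - 1)) else 0)"
proof -
  note mem = fun_upd_off_index[OF m ik(1)] fun_upd_off_index[OF m ik(2)]
  note eqs = fun_upd_off_index_eq_iff[OF ik] fun_upd_off_index_eq_iff[OF ik(1,1)]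
    fun_upd_off_index_eq_iff[OF ik(2,2)] fun_upd_off_index_eq_iff[OF ik(2,1)]
  consider "s \<noteq> t" "u \<noteq> s" | "s \<noteq> t" "u = s" | "s = t" "u = s" "i = k"
    | "s = t" "u \<noteq> s \<or> i \<noteq> k"
    by blast
  thus ?thesis
  proof cases
    case 1
    thus ?thesis
      using stu fourth_order_moment_isolated[of "i(m := s)" "k(m := u)" "k(m := u)" "i(m := t)"] mem
      by (simp add: eqs mult_ac)
  next
    case 2
    thus ?thesis
      using stu fourth_order_moment_isolated[of "i(m := t)" "k(m := u)" "k(m := u)" "i(m := s)"] mem
      by (simp add: eqs mult_ac)
  next
    case 3
    thus ?thesis
      using stu \<beta>[of "i(m := s)"] mem by (simp add: power4_eq_xxxx)
  next
    case 4
    thus ?thesis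
      using stu fourth_order_moment_pairs[of "k(m := u)" "i(m := s)"] mem
      by (auto simp: eqs)
  qed
qed

text \<open>On the diagonal, \<rho>^2 triples (u, i, k) have \<open>u = s\<close>,
  \<open>p m\<close> times \<rho> have \<open>k = i\<close>, and the \<rho> triples with both carry
  a fourth moment instead of 1 + 1. This gives \<rho> (p + \<rho> - 2) plus the face sum of
  \<beta>.\<close>

lemma expect_inner_square:
  defines "\<rho> \<equiv> real (rho r p m)"
  assumes st: "s < p m" "t < p m"
  shows "integrable M (\<lambda>\<omega>. (N m \<omega> ^\<^sub>m 2) $$ (s, t))"
    and "expectation (\<lambda>\<omega>. (N m \<omega> ^\<^sub>m 2) $$ (s, t)) =
      (if s = t then \<rho> * (real (p m) - 1 + \<rho> - 1) + (\<Sum>i\<in>off_index r p m. \<beta> (i(m := s))) else 0)"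
proof -
  let ?O = "off_index r p m"
  let ?z = "\<lambda>\<omega> u i k. Z \<omega> (i(m := s)) * Z \<omega> (i(m := u)) * Z \<omega> (k(m := u)) * Z \<omega> (k(m := t))"
  have ex: "(N m \<omega> ^\<^sub>m 2) $$ (s, t) = (\<Sum>u<p m. \<Sum>i\<in>?O. \<Sum>k\<in>?O. ?z \<omega> u i k)" for \<omega>
  proof -
    have "N m \<omega> ^\<^sub>m 2 = N m \<omega> * N m \<omega>"
      using left_mult_one_mat[OF mode_inner_carrier[of r p m "Z \<omega>" "Z \<omega>"]]
      by (simp add: numeral_2_eq_2 mode_inner_def)
    hence "(N m \<omega> ^\<^sub>m 2) $$ (s, t) = (\<Sum>u<p m. N m \<omega> $$ (s, u) * N m \<omega> $$ (u, t))"
      using st by (simp add: index_mult_mat_sum[of "N m \<omega>" "p m" "p m" "N m \<omega>" "p m"]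
          mode_inner_carrier del: index_mult_mat(1))
    also have "\<dots> = (\<Sum>u<p m. \<Sum>i\<in>?O. \<Sum>k\<in>?O. ?z \<omega> u i k)"
      using st by (intro sum.cong refl) (simp add: mode_inner_def sum_product mult.assoc)
    finally show ?thesis .
  qed
  have int: "integrable M (\<lambda>\<omega>. ?z \<omega> u i k)" if "u < p m" "i \<in> ?O" "k \<in> ?O" for u i k
    using that st by (intro fourth_order_moment(1) fun_upd_off_index[OF m])
  show "integrable M (\<lambda>\<omega>. (N m \<omega> ^\<^sub>m 2) $$ (s, t))"
    unfolding ex by (intro Bochner_Integration.integrable_sum int) auto
  have "expectation (\<lambda>\<omega>. (N m \<omega> ^\<^sub>m 2) $$ (s, t)) =
      (\<Sum>u<p m. \<Sum>i\<in>?O. \<Sum>k\<in>?O. expectation (\<lambda>\<omega>. ?z \<omega> u i k))"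
    unfolding ex using int by (simp add: Bochner_Integration.integral_sum)
  also have "\<dots> = (\<Sum>u<p m. \<Sum>i\<in>?O. \<Sum>k\<in>?O. if s = t
      then of_bool (u = s) + of_bool (k = i) * (1 + of_bool (u = s) * (\<beta> (i(m := s)) - 2)) else 0)"
    using st by (intro sum.cong refl expectation_inner_square_term) auto
  also have "\<dots> = (if s = t then \<rho> * (real (p m) - 1 + \<rho> - 1) + (\<Sum>i\<in>?O. \<beta> (i(m := s))) else 0)"
  proof (cases "s = t")
    case True
    have "(\<Sum>u<p m. \<Sum>i\<in>?O. \<Sum>k\<in>?O.
        of_bool (u = s) + of_bool (k = i) * (1 + of_bool (u = s) * (\<beta> (i(m := s)) - 2))) =
      (\<Sum>u<p m. \<Sum>i\<in>?O. of_bool (u = s) * \<rho> + (1 + of_bool (u = s) * (\<beta> (i(m := s)) - 2)))"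
      by (intro sum.cong refl)
        (simp only: sum.distrib sum_of_bool_eq_mult[OF finite_off_index] sum_constant card_off_index
          \<rho>_def mult.commute)
    also have "\<dots> = (\<Sum>u<p m. of_bool (u = s) * (\<rho> * \<rho> + ((\<Sum>i\<in>?O. \<beta> (i(m := s))) - 2 * \<rho>)) + \<rho>)"
      by (intro sum.cong refl)
        (simp add: sum.distrib sum_subtractf card_off_index \<rho>_def algebra_simps flip: sum_distrib_left)
    also have "\<dots> = \<rho> * \<rho> + ((\<Sum>i\<in>?O. \<beta> (i(m := s))) - 2 * \<rho>) + real (p m) * \<rho>"
      using st by (simp only: sum.distrib sum_of_bool_eq_mult finite_lessThan lessThan_iff) simp
    finally show ?thesis
      using True by (simp add: algebra_simps)
  qed simp
  finally show "expectation (\<lambda>\<omega>. (N m \<omega> ^\<^sub>m 2) $$ (s, t)) =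
      (if s = t then \<rho> * (real (p m) - 1 + \<rho> - 1) + (\<Sum>i\<in>?O. \<beta> (i(m := s))) else 0)" .
qed

text \<open>On the diagonal all \<open>p m\<close> times \<rho>^2 triples contribute; \<rho> of them
  are fourth moments rather than 1.\<close>

lemma expect_norm_inner:
  defines "\<rho> \<equiv> real (rho r p m)"
  assumes st: "s < p m" "t < p m"
  shows "integrable M (\<lambda>\<omega>. ((tensor_fnorm r p (Z \<omega>))\<^sup>2 \<cdot>\<^sub>m N m \<omega>) $$ (s, t))"
    and "expectation (\<lambda>\<omega>. ((tensor_fnorm r p (Z \<omega>))\<^sup>2 \<cdot>\<^sub>m N m \<omega>) $$ (s, t)) =
      (if s = t then \<rho> * (real (p m) * \<rho> - 1) + (\<Sum>i\<in>off_index r p m. \<beta> (i(m := s))) else 0)"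
proof -
  let ?O = "off_index r p m"
  let ?z = "\<lambda>\<omega> u i k. Z \<omega> (k(m := u)) * Z \<omega> (k(m := u)) * Z \<omega> (i(m := s)) * Z \<omega> (i(m := t))"
  have ex: "((tensor_fnorm r p (Z \<omega>))\<^sup>2 \<cdot>\<^sub>m N m \<omega>) $$ (s, t) = (\<Sum>u<p m. \<Sum>k\<in>?O. \<Sum>i\<in>?O. ?z \<omega> u i k)" for \<omega>
    using st by (simp add: tensor_fnorm_square[OF m] mode_inner_def sum_distrib_right)
      (simp add: sum_distrib_left mult.assoc)
  have int: "integrable M (\<lambda>\<omega>. ?z \<omega> u i k)" if "u < p m" "i \<in> ?O" "k \<in> ?O" for u i k
    using that st by (intro fourth_order_moment(1) fun_upd_off_index[OF m])
  show "integrable M (\<lambda>\<omega>. ((tensor_fnorm r p (Z \<omega>))\<^sup>2 \<cdot>\<^sub>m N m \<omega>) $$ (s, t))"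
    unfolding ex by (intro Bochner_Integration.integrable_sum int) auto
  have "expectation (\<lambda>\<omega>. ((tensor_fnorm r p (Z \<omega>))\<^sup>2 \<cdot>\<^sub>m N m \<omega>) $$ (s, t)) =
      (\<Sum>u<p m. \<Sum>k\<in>?O. \<Sum>i\<in>?O. expectation (\<lambda>\<omega>. ?z \<omega> u i k))"
    unfolding ex using int by (simp add: Bochner_Integration.integral_sum)
  also have "\<dots> = (\<Sum>u<p m. \<Sum>k\<in>?O. \<Sum>i\<in>?O. if s = t then
      1 + of_bool (i = k) * (of_bool (u = s) * (\<beta> (i(m := s)) - 1)) else 0)"
    using st by (intro sum.cong refl expectation_norm_inner_term) auto
  also have "\<dots> = (if s = t then \<rho> * (real (p m) * \<rho> - 1) + (\<Sum>i\<in>?O. \<beta> (i(m := s))) else 0)"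
  proof (cases "s = t")
    case True
    have "(\<Sum>u<p m. \<Sum>k\<in>?O. \<Sum>i\<in>?O. 1 + of_bool (i = k) * (of_bool (u = s) * (\<beta> (i(m := s)) - 1))) =
      (\<Sum>u<p m. \<Sum>k\<in>?O. \<rho> + of_bool (u = s) * (\<beta> (k(m := s)) - 1))"
      by (intro sum.cong refl)
        (simp only: sum.distrib sum_of_bool_eq_mult[OF finite_off_index] sum_constant card_off_index
          \<rho>_def mult_1_right)
    also have "\<dots> = (\<Sum>u<p m. \<rho> * \<rho> + of_bool (u = s) * ((\<Sum>i\<in>?O. \<beta> (i(m := s))) - \<rho>))"
      by (intro sum.cong refl)
        (simp add: sum.distrib sum_subtractf card_off_index \<rho>_def flip: sum_distrib_left)
    also have "\<dots> = real (p m) * \<rho> * \<rho> + ((\<Sum>i\<in>?O. \<beta> (i(m := s))) - \<rho>)"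
      using st by (simp only: sum.distrib sum_of_bool_eq_mult finite_lessThan lessThan_iff) simp
    finally show ?thesis
      using True by (simp add: algebra_simps)
  qed simp
  finally show "expectation (\<lambda>\<omega>. ((tensor_fnorm r p (Z \<omega>))\<^sup>2 \<cdot>\<^sub>m N m \<omega>) $$ (s, t)) =
      (if s = t then \<rho> * (real (p m) * \<rho> - 1) + (\<Sum>i\<in>?O. \<beta> (i(m := s))) else 0)" .
qed

end

end

lemma tensor_ic_model_standardized_tensor:
  assumes model: "tensor_ic_model P r p \<mu> \<Omega> Z X"
    and "\<And>i. i \<in> tensor_index r p \<Longrightarrow> integrable P (\<lambda>\<omega>. (Z \<omega> i) ^ 4)"
  shows "standardized_tensor P Z r p"
proof -
  interpret prob_space P
    using model by (simp add: tensor_ic_model_def)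
  have source: "ic_source P r p Z"
    using model by (simp add: tensor_ic_model_def)
  \<comment> \<open>The model fixes a variance; with mean zero it is the second moment.\<close>
  have "expectation (\<lambda>\<omega>. (Z \<omega> i)\<^sup>2) = 1" if i: "i \<in> tensor_index r p" for i
  proof -
    have "expectation (\<lambda>\<omega>. Z \<omega> i) = 0"
      "expectation (\<lambda>\<omega>. (Z \<omega> i - expectation (\<lambda>\<omega>'. Z \<omega>' i))\<^sup>2) = 1"
      using source i unfolding ic_source_def by blast+
    thus ?thesis
      by simp
  qed
  thus ?thesis
    by unfold_locales (use source assms(2) in \<open>simp_all add: ic_source_def finite_tensor_index\<close>)
qed

section \<open>Both matrices for a scaled rotation of the standardized tensor\<close>

context standardized_tensor
begin

text \<open>Isolates all that standardization has to provide: a scalar \<open>c\<close> and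
  orthonormal factors \<open>W\<close>. Each quadratic factor of the integrand contributes one
  c^2.\<close>

lemma B0_B1_orthonormal:
  assumes m: "m < r" and pos: "\<And>j. j < r \<Longrightarrow> p j > 0"
    and W: "\<And>j. j < r \<Longrightarrow> orthonormal_mat (p j) (W j)"
    and Y: "\<And>\<omega> i. \<omega> \<in> space M \<Longrightarrow> i \<in> tensor_index r p \<Longrightarrow> Y \<omega> i = c * all_modes_prod r (Z \<omega>) W i"
    and \<beta>: "\<And>i. i \<in> tensor_index r p \<Longrightarrow> \<beta> i = expectation (\<lambda>\<omega>. Z \<omega> i ^ 4)"
  defines "\<rho> \<equiv> real (rho r p m)"
  shows "B0_mat M r p m Y = c ^ 4 \<cdot>\<^sub>m (W m * ((real (p m) - 1 + \<rho> - 1) \<cdot>\<^sub>m 1\<^sub>m (p m)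
      + diag_of_vec (face_means r p m \<beta>)) * (W m)\<^sup>T)"
    and "B1_mat M r p m Y = c ^ 4 \<cdot>\<^sub>m (W m * ((real (p m) * \<rho> - 1) \<cdot>\<^sub>m 1\<^sub>m (p m)
      + diag_of_vec (face_means r p m \<beta>)) * (W m)\<^sup>T)"
proof -
  let ?n = "p m"
  note [simp] = assoc_mult_mat[of _ ?n ?n _ ?n _ ?n] mult_smult_distrib[of _ ?n ?n _ ?n]
    mult_smult_assoc_mat[of _ ?n ?n _ ?n] left_mult_one_mat[of _ ?n ?n]
  have cW: "W m \<in> carrier_mat ?n ?n" "(W m)\<^sup>T \<in> carrier_mat ?n ?n" and WW: "(W m)\<^sup>T * W m = 1\<^sub>m ?n"
    using W[OF m] by (auto simp: orthonormal_mat_def)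
  have cN: "N m \<omega> \<in> carrier_mat ?n ?n" for \<omega>
    by (rule mode_inner_carrier)
  have \<rho>: "\<rho> > 0"
    using pos by (auto simp: \<rho>_def rho_def intro!: prod_pos)
  have YN: "mode_inner r p m (Y \<omega>) (Y \<omega>) = c\<^sup>2 \<cdot>\<^sub>m (W m * N m \<omega> * (W m)\<^sup>T)" if "\<omega> \<in> space M" for \<omega>
  proof -
    have "mode_inner r p m (all_modes_prod r (Z \<omega>) W) (all_modes_prod r (Z \<omega>) W) = W m * N m \<omega> * (W m)\<^sup>T"
      using m W by (rule mode_inner_orthonormal)
    thus ?thesis
      using mode_inner_cong[OF m, of p "Y \<omega>", OF Y[OF that]] by (simp only: mode_inner_smult)
  qed
  \<comment> \<open>Squaring commutes with conjugation because the inner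
    \<open>(W m)\<^sup>T * W m\<close> cancels.\<close>
  have sq: "mode_inner r p m (Y \<omega>) (Y \<omega>) ^\<^sub>m 2 = c ^ 4 \<cdot>\<^sub>m (W m * (N m \<omega> ^\<^sub>m 2) * (W m)\<^sup>T)"
    if "\<omega> \<in> space M" for \<omega>
  proof -
    have pow2: "A ^\<^sub>m 2 = A * A" if "A \<in> carrier_mat ?n ?n" for A :: "real mat"
      using that by (simp add: numeral_2_eq_2)
    define K where "K = W m * N m \<omega> * (W m)\<^sup>T"
    have cK: "K \<in> carrier_mat ?n ?n"
      using cW by (auto simp: K_def)
    have "mode_inner r p m (Y \<omega>) (Y \<omega>) ^\<^sub>m 2 = (c\<^sup>2 * c\<^sup>2) \<cdot>\<^sub>m (K * K)"
      unfolding YN[OF that] K_def[symmetric] using cK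
      by (simp add: pow2 smult_smult_mat)
    also have "K * K = W m * (N m \<omega> * (((W m)\<^sup>T * W m) * (N m \<omega> * (W m)\<^sup>T)))"
      unfolding K_def using cW cN[of \<omega>] by simp
    also have "\<dots> = W m * (N m \<omega> ^\<^sub>m 2) * (W m)\<^sup>T"
      unfolding WW using cW cN[of \<omega>] by (simp add: pow2)
    finally show ?thesis
      by (simp flip: power_add)
  qed
  \<comment> \<open>The squared norm is the trace of the m-mode product, hence unchanged by the
    rotation.\<close>
  have norm: "(tensor_fnorm r p (Y \<omega>))\<^sup>2 \<cdot>\<^sub>m mode_inner r p m (Y \<omega>) (Y \<omega>) =
      c ^ 4 \<cdot>\<^sub>m (W m * ((tensor_fnorm r p (Z \<omega>))\<^sup>2 \<cdot>\<^sub>m N m \<omega>) * (W m)\<^sup>T)" if "\<omega> \<in> space M" for \<omega>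
  proof -
    have "(tensor_fnorm r p (Y \<omega>))\<^sup>2 = (\<Sum>s<?n. c\<^sup>2 * (W m * N m \<omega> * (W m)\<^sup>T) $$ (s, s))"
      unfolding tensor_fnorm_square[OF m] YN[OF that] using cW
      by (intro sum.cong refl index_smult_mat) auto
    also have "\<dots> = c\<^sup>2 * (tensor_fnorm r p (Z \<omega>))\<^sup>2"
      by (simp only: sum_diag_conj_orthonormal[OF W[OF m] cN] tensor_fnorm_square[OF m]
          flip: sum_distrib_left)
    finally have "(tensor_fnorm r p (Y \<omega>))\<^sup>2 = c\<^sup>2 * (tensor_fnorm r p (Z \<omega>))\<^sup>2" .
    thus ?thesis
      unfolding YN[OF that] using cW cN
      by (simp add: smult_smult_mat mult.commute mult.left_commute flip: power_add)
  qed
  \<comment> \<open>Both expectations are diagonal with entries \<rho> a plus a face sum, so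
    dividing by \<rho> leaves a plus a face mean.\<close>
  have diag: "(1 / \<rho>) \<cdot>\<^sub>m expect_mat M ?n F = a \<cdot>\<^sub>m 1\<^sub>m ?n + diag_of_vec (face_means r p m \<beta>)"
    if F: "\<And>s t. s < ?n \<Longrightarrow> t < ?n \<Longrightarrow> expectation (\<lambda>\<omega>. F \<omega> $$ (s, t)) =
      (if s = t then \<rho> * a + (\<Sum>i\<in>off_index r p m. \<beta> (i(m := s))) else 0)" for F a
    using \<rho> m by (intro eq_matI)
      (auto simp: expect_mat_def F diag_of_vec_def face_means_def mat_diag_def sum_face add_divide_distrib
        simp flip: \<rho>_def)
  have conj: "(1 / \<rho>) \<cdot>\<^sub>m expect_mat M ?n (\<lambda>\<omega>. c ^ 4 \<cdot>\<^sub>m (W m * F \<omega> * (W m)\<^sup>T)) =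
      c ^ 4 \<cdot>\<^sub>m (W m * ((1 / \<rho>) \<cdot>\<^sub>m expect_mat M ?n F) * (W m)\<^sup>T)"
    if "\<And>\<omega>. F \<omega> \<in> carrier_mat ?n ?n"
      "\<And>s t. s < ?n \<Longrightarrow> t < ?n \<Longrightarrow> integrable M (\<lambda>\<omega>. F \<omega> $$ (s, t))" for F
  proof -
    have "expect_mat M ?n F \<in> carrier_mat ?n ?n"
      by (simp add: expect_mat_def)
    thus ?thesis
      using cW by (subst expect_mat_conj[OF cW(1) that]) (simp_all add: smult_smult_mat mult.commute)
  qed
  have "B0_mat M r p m Y = (1 / \<rho>) \<cdot>\<^sub>m expect_mat M ?n (\<lambda>\<omega>. c ^ 4 \<cdot>\<^sub>m (W m * (N m \<omega> ^\<^sub>m 2) * (W m)\<^sup>T))"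
    unfolding B0_mat_def \<rho>_def[symmetric] by (intro arg_cong2[where f = "(\<cdot>\<^sub>m)"] refl expect_mat_cong sq)
  also have "\<dots> = c ^ 4 \<cdot>\<^sub>m (W m * ((1 / \<rho>) \<cdot>\<^sub>m expect_mat M ?n (\<lambda>\<omega>. N m \<omega> ^\<^sub>m 2)) * (W m)\<^sup>T)"
    using m \<beta> cN by (intro conj expect_inner_square(1)) auto
  also have "(1 / \<rho>) \<cdot>\<^sub>m expect_mat M ?n (\<lambda>\<omega>. N m \<omega> ^\<^sub>m 2) =
      (real (p m) - 1 + \<rho> - 1) \<cdot>\<^sub>m 1\<^sub>m (p m) + diag_of_vec (face_means r p m \<beta>)"
    unfolding \<rho>_def using m \<beta> by (intro diag[unfolded \<rho>_def] expect_inner_square(2)) auto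
  finally show "B0_mat M r p m Y = c ^ 4 \<cdot>\<^sub>m (W m * ((real (p m) - 1 + \<rho> - 1) \<cdot>\<^sub>m 1\<^sub>m (p m)
      + diag_of_vec (face_means r p m \<beta>)) * (W m)\<^sup>T)" .
  have "B1_mat M r p m Y = (1 / \<rho>) \<cdot>\<^sub>m expect_mat M ?n
      (\<lambda>\<omega>. c ^ 4 \<cdot>\<^sub>m (W m * ((tensor_fnorm r p (Z \<omega>))\<^sup>2 \<cdot>\<^sub>m N m \<omega>) * (W m)\<^sup>T))"
    unfolding B1_mat_def \<rho>_def[symmetric] by (intro arg_cong2[where f = "(\<cdot>\<^sub>m)"] refl expect_mat_cong norm)
  also have "\<dots> = c ^ 4 \<cdot>\<^sub>m (W m * ((1 / \<rho>) \<cdot>\<^sub>m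
      expect_mat M ?n (\<lambda>\<omega>. (tensor_fnorm r p (Z \<omega>))\<^sup>2 \<cdot>\<^sub>m N m \<omega>)) * (W m)\<^sup>T)"
    using m \<beta> cN by (intro conj expect_norm_inner(1)) auto
  also have "(1 / \<rho>) \<cdot>\<^sub>m expect_mat M ?n (\<lambda>\<omega>. (tensor_fnorm r p (Z \<omega>))\<^sup>2 \<cdot>\<^sub>m N m \<omega>) =
      (real (p m) * \<rho> - 1) \<cdot>\<^sub>m 1\<^sub>m (p m) + diag_of_vec (face_means r p m \<beta>)"
    unfolding \<rho>_def using m \<beta> by (intro diag[unfolded \<rho>_def] expect_norm_inner(2)) auto
  finally show "B1_mat M r p m Y = c ^ 4 \<cdot>\<^sub>m (W m * ((real (p m) * \<rho> - 1) \<cdot>\<^sub>m 1\<^sub>m (p m)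
      + diag_of_vec (face_means r p m \<beta>)) * (W m)\<^sup>T)" .
qed

end

section \<open>Standardization\<close>

text \<open>Since \<open>p j > 0\<close>, the entry (0, 0) exists; being positive, it keeps the
  Frobenius norm of \<open>D j\<close> from vanishing.\<close>

lemma mode_scale_pos:
  assumes "\<And>j. j < r \<Longrightarrow> p j > 0" and "\<And>j. j < r \<Longrightarrow> is_svd (p j) (\<Omega> j) (U j) (D j) (V j)"
  shows "mode_scale r p D m > 0"
  unfolding mode_scale_def
proof (intro prod_pos ballI)
  fix j assume "j \<in> {..<r} - {m}"
  hence j: "j < r" by simp
  have D: "D j \<in> carrier_mat (p j) (p j)" "D j $$ (0, 0) > 0"
    using assms(1,2)[OF j] by (auto simp: is_svd_def)
  have "0 < (D j $$ (0, 0))\<^sup>2"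
    using D by simp
  also have "\<dots> \<le> (\<Sum>y<p j. (D j $$ (0, y))\<^sup>2)"
    using assms(1)[OF j] by (intro member_le_sum) auto
  also have "\<dots> \<le> (\<Sum>x<p j. \<Sum>y<p j. (D j $$ (x, y))\<^sup>2)"
    using assms(1)[OF j] by (intro member_le_sum[where f = "\<lambda>x. \<Sum>y<p j. (D j $$ (x, y))\<^sup>2"]) (auto intro: sum_nonneg)
  finally have "mat_fnorm (D j) > 0"
    using D by (simp add: mat_fnorm_def)
  thus "0 < sqrt (real (p j)) * inverse (mat_fnorm (D j))"
    using assms(1)[OF j] by simp
qed

text \<open>The left singular vectors and the singular values cancel between \<open>G\<close> and
  \<open>A\<close>; the rotation left over is the matrix W of the claim.\<close>

lemma orthogonal_factor_mult:
  assumes svd: "is_svd (p m) A (U m) (D m) (V m)" and Q: "orthogonal_factor r p U D m G Q"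
  shows "G * A = mode_scale r p D m \<cdot>\<^sub>m (Q * (V m)\<^sup>T)"
proof -
  let ?n = "p m" and ?E = "the (mat_inverse (D m))"
  note [simp] = assoc_mult_mat[of _ ?n ?n _ ?n _ ?n] mult_smult_assoc_mat[of _ ?n ?n _ ?n]
    left_mult_one_mat[of _ ?n ?n]
  have carr: "U m \<in> carrier_mat ?n ?n" "(U m)\<^sup>T \<in> carrier_mat ?n ?n" "D m \<in> carrier_mat ?n ?n"
    "(V m)\<^sup>T \<in> carrier_mat ?n ?n" "Q \<in> carrier_mat ?n ?n" "?E \<in> carrier_mat ?n ?n"
    and UU: "(U m)\<^sup>T * U m = 1\<^sub>m ?n" and A: "A = U m * D m * (V m)\<^sup>T"
    and G: "G = mode_scale r p D m \<cdot>\<^sub>m (Q * ?E * (U m)\<^sup>T)"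
    using svd Q is_svd_inverse[OF svd] by (auto simp: is_svd_def orthonormal_mat_def orthogonal_factor_def)
  have "G * A = mode_scale r p D m \<cdot>\<^sub>m
      (Q * (?E * (((U m)\<^sup>T * U m) * (D m * (V m)\<^sup>T))))"
    unfolding G A using carr by simp
  also have "\<dots> = mode_scale r p D m \<cdot>\<^sub>m (Q * ((?E * D m) * (V m)\<^sup>T))"
    unfolding UU using carr by simp
  also have "\<dots> = mode_scale r p D m \<cdot>\<^sub>m (Q * (V m)\<^sup>T)"
    unfolding is_svd_inverse(3)[OF svd] using carr by simp
  finally show ?thesis .
qed

text \<open>The first conjunct ensures that the family \<open>M\<close> quantified in the second one
  exists and is determined on the modes below \<open>r\<close>.\<close>

theorem theorem5p4p1:
  fixes P :: "'w measure" and r :: nat and p :: "nat \<Rightarrow> nat"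
    and \<Omega> U D V G :: "nat \<Rightarrow> real mat"
    and Z X Xst :: "'w \<Rightarrow> tensor" and \<beta> :: tensor
  assumes model: "tensor_ic_model P r p (\<lambda>_. 0) \<Omega> Z X"
    and fourth_moments: "\<And>i. i \<in> tensor_index r p \<Longrightarrow> integrable P (\<lambda>\<omega>. (Z \<omega> i) ^ 4)"
    and inv_sqrt: "\<And>m. m < r \<Longrightarrow> inverse_sqrt_of (p m) (mode_cov P r p m X) (G m)"
    and svd: "\<And>m. m < r \<Longrightarrow> is_svd (p m) (\<Omega> m) (U m) (D m) (V m)"
    and Xst_def: "\<And>\<omega>. Xst \<omega> = all_modes_prod r (X \<omega>) G"
    and \<beta>_def: "\<And>i. i \<in> tensor_index r p \<Longrightarrow> \<beta> i = (\<integral>\<omega>. (Z \<omega> i) ^ 4 \<partial>P)"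
  shows "(\<forall>m<r. \<exists>!Q. orthogonal_factor r p U D m (G m) Q) \<and>
    (\<forall>M. (\<forall>m<r. orthogonal_factor r p U D m (G m) (M m)) \<longrightarrow>
      (\<forall>m<r. let W = M m * (V m)\<^sup>T; \<rho> = real (rho r p m); \<tau> = tau r p D in
        B0_mat P r p m Xst =
          \<tau> ^ 4 \<cdot>\<^sub>m (W * ((real (p m) - 1 + \<rho> - 1) \<cdot>\<^sub>m 1\<^sub>m (p m)
                        + diag_of_vec (face_means r p m \<beta>)) * W\<^sup>T) \<and>
        B1_mat P r p m Xst =
          \<tau> ^ 4 \<cdot>\<^sub>m (W * ((real (p m) * \<rho> - 1) \<cdot>\<^sub>m 1\<^sub>m (p m)
                        + diag_of_vec (face_means r p m \<beta>)) * W\<^sup>T)))"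
proof -
  interpret standardized_tensor P Z r p
    by (rule tensor_ic_model_standardized_tensor[OF model fourth_moments])
  have pos: "p m > 0" and \<Omega>: "\<Omega> m \<in> carrier_mat (p m) (p m)" if "m < r" for m
    using model that by (auto simp: tensor_ic_model_def)
  have X: "X \<omega> i = all_modes_prod r (Z \<omega>) \<Omega> i" if "\<omega> \<in> space P" "i \<in> tensor_index r p" for \<omega> i
    using model that by (simp add: tensor_ic_model_def)
  have scale_pos: "mode_scale r p D m > 0" for m
    using pos svd by (rule mode_scale_pos)
  have cov: "mode_cov P r p m X = inverse ((mode_scale r p D m)\<^sup>2) \<cdot>\<^sub>m (\<Omega> m * (\<Omega> m)\<^sup>T)" if m: "m < r" for m
  proof -
    \<comment> \<open>Each mode j \<noteq> m contributes its squared norm over \<open>p j\<close>,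
      the inverse square of its factor in \<open>mode_scale\<close>.\<close>
    have scale: "1 / real (rho r p m) * (\<Prod>j\<in>{..<r} - {m}. (mat_fnorm (D j))\<^sup>2) = inverse ((mode_scale r p D m)\<^sup>2)"
      by (simp add: mode_scale_def rho_def prod_power_distrib power_mult_distrib power_divide
          prod_dividef power_inverse divide_inverse prod.distrib mult.commute flip: prod_inversef)
    have "expect_mat P (p m) (\<lambda>\<omega>. mode_inner r p m (X \<omega>) (X \<omega>)) =
        expect_mat P (p m) (\<lambda>\<omega>. mode_inner r p m (all_modes_prod r (Z \<omega>) \<Omega>) (all_modes_prod r (Z \<omega>) \<Omega>))"
      using m X by (intro expect_mat_cong mode_inner_cong)
    also have "\<dots> = (\<Prod>j\<in>{..<r} - {m}. (mat_fnorm (\<Omega> j))\<^sup>2) \<cdot>\<^sub>m (\<Omega> m * (\<Omega> m)\<^sup>T)"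
      using m \<Omega> by (rule expect_mode_inner_all_modes_prod)
    also have "(\<Prod>j\<in>{..<r} - {m}. (mat_fnorm (\<Omega> j))\<^sup>2) = (\<Prod>j\<in>{..<r} - {m}. (mat_fnorm (D j))\<^sup>2)"
      using is_svd_fnorm[OF svd] by (intro prod.cong) auto
    finally show ?thesis
      unfolding mode_cov_def by (simp only: smult_smult_mat scale)
  qed
  have "\<exists>!Q. orthogonal_factor r p U D m (G m) Q" if m: "m < r" for m
    unfolding orthogonal_factor_def
    using svd[OF m] scale_pos[of m] inv_sqrt[OF m]
    by (intro inverse_sqrt_orthogonal_factor) (simp_all add: cov[OF m])
  moreover have "let W = M m * (V m)\<^sup>T; \<rho> = real (rho r p m); \<tau> = tau r p D in
        B0_mat P r p m Xst =
          \<tau> ^ 4 \<cdot>\<^sub>m (W * ((real (p m) - 1 + \<rho> - 1) \<cdot>\<^sub>m 1\<^sub>m (p m)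
                        + diag_of_vec (face_means r p m \<beta>)) * W\<^sup>T) \<and>
        B1_mat P r p m Xst =
          \<tau> ^ 4 \<cdot>\<^sub>m (W * ((real (p m) * \<rho> - 1) \<cdot>\<^sub>m 1\<^sub>m (p m)
                        + diag_of_vec (face_means r p m \<beta>)) * W\<^sup>T)"
    if M: "\<forall>m<r. orthogonal_factor r p U D m (G m) (M m)" and m: "m < r" for M m
  proof -
    define W where "W = (\<lambda>m. M m * (V m)\<^sup>T)"
    have W: "orthonormal_mat (p j) (W j)" if "j < r" for j
      unfolding W_def using M svd that
      by (intro orthonormal_mat_mult_transpose) (auto simp: orthogonal_factor_def is_svd_def)
    have G: "G j \<in> carrier_mat (p j) (p j)" if "j < r" for j
      using inv_sqrt[OF that] by (simp add: inverse_sqrt_of_def)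
    \<comment> \<open>In every mode \<open>G j * \<Omega> j\<close> is
      \<open>mode_scale r p D j\<close> times \<open>W j\<close>; by multilinearity the scalars
      leave the product and combine to \<open>tau\<close>.\<close>
    have "Xst \<omega> i = tau r p D * all_modes_prod r (Z \<omega>) W i"
      if "\<omega> \<in> space P" "i \<in> tensor_index r p" for \<omega> i
    proof -
      have "Xst \<omega> i = all_modes_prod r (Z \<omega>) (\<lambda>j. G j * \<Omega> j) i"
        unfolding Xst_def using \<Omega> G X[OF that(1)] that(2) by (rule all_modes_prod_comp)
      also have "\<dots> = tau r p D * all_modes_prod r (Z \<omega>) W i"
        unfolding tau_def
      proof (rule all_modes_prod_smult[OF _ _ that(2)])
        show "W j \<in> carrier_mat (p j) (p j)" if "j < r" for j
          using W[OF that] by (simp add: orthonormal_mat_def)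
        show "G j * \<Omega> j = mode_scale r p D j \<cdot>\<^sub>m W j" if "j < r" for j
          unfolding W_def using orthogonal_factor_mult svd[OF that] M that by blast
      qed
      finally show ?thesis .
    qed
    from B0_B1_orthonormal[OF m pos W this \<beta>_def]
    show ?thesis
      unfolding Let_def W_def by simp
  qed
  ultimately show ?thesis
    by blast
qed

end
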